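(* Let $\underline R$ be a commutative square ring. There is a category $\mathsf{CP}_{\underline R}$ whose objects are the $\underline R$-CP-modules and whose morphisms are the $\underline R$-CP-quadratic maps (with the usual composition of maps). This category is prequadratic on the right, and it admits an internal Hom functor.
   Context: A square ring $\underline R=(R_e\xrightarrow{H}R_{ee}\xrightarrow{P}R_e)$ consists of: a set $R_e$ with a group structure $+$ (not necessarily commutative) and an associative unital multiplication satisfying $r(s+t)=rs+rt$ (the law $(r+s)t=rt+st$ is not required); an abelian group $R_{ee}$; a map $R_e\times R_e\times R_{ee}\times R_e\to R_{ee}$, $(r,s,x,t)\mapsto(r,s)\cdot x\cdot t$, additive in each of its four variables and defining commuting actions on $R_{ee}$ of the multiplicative monoids $R_e\times R_e$ (on the left) and $R_e$ (on the right) (write $(r,s)\cdot x$ if $t=1$ and $x\cdot t$ if $r=s=1$); a group homomorphism $T:R_{ee}\to R_{ee}$ with $T^2=\mathrm{Id}$; a map $H:R_e\to R_{ee}$ and a group homomorphism $P:R_{ee}\to R_e$; such that for all $r,s,t\in R_e$, $x,y\in R_{ee}$: $PHP=P+P$; $P((r,r)\cdot x\cdot s)=rP(x)s$; $T=HP-\mathrm{Id}$; $PT=P$; $(P(x),r)\cdot y=(r,P(x))\cdot y=0=y\cdot P(x)$; $H(r+s)=H(r)+H(s)+(s,r)\cdot H(2)$ where $2=1+1$; $H(rs)=(r,r)\cdot H(s)+H(r)\cdot s$; $(r+s)t=rt+st+P((r,s)\cdot H(t))$; $T((r,s)\cdot x\cdot t)=(s,r)\cdot T(x)\cdot t$. The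 quotient $\overline R=R_e/\operatorname{Im}P$ is a ring. $\underline R$ is commutative if $\overline R$ is commutative and $(r,1)\cdot x=(1,r)\cdot x=x\cdot r$ for all $r\in R_e$, $x\in R_{ee}$. A (right) $\underline R$-BHP-module is a group $M$ (written additively, not necessarily commutative) with operations $M\times R_e\to M$, $(m,r)\mapsto m\cdot r$ and $M\times M\times R_{ee}\to M$, $(m,n,x)\mapsto[m,n]\cdot x$ such that: $m\cdot1=m$, $(m\cdot r)\cdot s=m\cdot(rs)$, $m\cdot(r+s)=m\cdot r+m\cdot s$; $(m+n)\cdot r=m\cdot r+n\cdot r+[m,n]\cdot H(r)$; $m\cdot P(x)=[m,m]\cdot x$; $[m,n]\cdot T(x)=[n,m]\cdot x$; $[m,n]\cdot x$ is additive in each of $m,n,x$; $([m\cdot r,n\cdot s]\cdot x)\cdot t=[m,n]\cdot((r,s)\cdot x\cdot t)$; $[[m,m']\cdot x,n]\cdot y=0$. An $\underline R$-CP-module is a pair $(M,A)$ where $M$ is an $\underline R$-BHP-module and $A$ is a subgroup of $M$, stable under the action of $R_e$, such that $[m,n]\cdot x=0$ whenever $m\in A$, and $[m,n]\cdot x\in A$ for all $m,n\in M$, $x\in R_{ee}$. A map between BHP-modules is $\underline R$-linear if it is additive and commutes with the operations $\cdot r$ ($r\in R_e$) and $[-,-]\cdot x$ ($x\in R_{ee}$); a map $M\times M\to N$ is $\underline R$-bilinear if it is $\underline R$-linear in each variable separately. For a map $f:M\to N$ of BHP-modules put $d_f(m,m')=f(m+m')-f(m')-f(m)$; $f_{(r)}(m)=f(m\cdot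 r)-f(m)\cdot r$ for $r\in R_e$; $f_{[x]}(m,m')=f([m,m']\cdot x)-[f(m),f(m')]\cdot x$ for $x\in R_{ee}$. For a map $g$ from a set to a BHP-module $N$, $\operatorname{Im}_{\underline R}g$ is the smallest subgroup of $N$ containing the image of $g$ and stable under the operations of $R_e$ and $R_{ee}$. For $\underline R$ commutative, a map $f:(M,A)\to(N,B)$ of $\underline R$-CP-modules (i.e. a map $f:M\to N$) is $\underline R$-CP-quadratic if: (1) $f(A)$, $\operatorname{Im}_{\underline R}d_f$, $\operatorname{Im}_{\underline R}f_{(r)}$, $\operatorname{Im}_{\underline R}f_{[x]}$ are contained in $B$ for all $r\in R_e,x\in R_{ee}$; (2) $d_f$ and all $f_{[x]}$ are $\underline R$-bilinear; (3) $f_{(r)}(m\cdot s)=f_{(r)}(m)\cdot s^2$ for all $m\in M$, $r,s\in R_e$; (4) $d_f(M,A)=d_f(A,M)=0$, $f_{(r)}(A)=0$, $f_{[x]}(M,A)=f_{[x]}(A,M)=0$ for all $r,x$. A category is prequadratic on the right if each Hom set carries a group structure (written $+$; here it is pointwise addition of maps) such that for each morphism $f$ the precomposition map $g\mapsto g\circ f$ is a group homomorphism, and for each morphism $g$ the postcomposition map $f\mapsto g\circ f$ is quadratic, i.e. $(f_1,f_2)\mapsto g\circ(f_1+f_2)-g\circ f_2-g\circ f_1$ is additive in each variable. The internal Hom functor is the functor $\mathsf{CP}_{\underline R}^{op}\times\mathsf{CP}_{\underline R}\to\mathsf{CP}_{\underline R}$ sending $((M,A),(N,B))$ to the pair whose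 first member is the set of all $\underline R$-CP-quadratic maps $(M,A)\to(N,B)$ and whose second member is the set of all $\underline R$-CP-quadratic maps $(M,A)\to(B,0)$, with pointwise operations, and acting on morphisms by pre- and postcomposition.
   Formalization: The second member of the internal Hom is taken to be the CP-quadratic maps f:(M,A)→(N,B) with f(M)⊆B and f(A)=0; read literally, CP-quadratic maps to the CP-module (B,0) are linear, and the claim fails (R=Z, postcomposition with g(m)=m² from (Z,0) to (Z,Z)). *)

theory Defs
  imports "HOL-Algebra.QuotRing" "HOL-Library.FuncSet"
begin

section \<open>Additive notation for groups\<close>

text \<open>Groups are groups in the sense of HOL-Algebra, written additively here and not
  assumed commutative.\<close>

abbreviation (input) gadd :: "('a, 'k) monoid_scheme \<Rightarrow> 'a \<Rightarrow> 'a \<Rightarrow> 'a" (infixl "\<boxplus>\<index>" 65)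
  where "x \<boxplus>\<^bsub>G\<^esub> y \<equiv> x \<otimes>\<^bsub>G\<^esub> y"

abbreviation (input) gsub :: "('a, 'k) monoid_scheme \<Rightarrow> 'a \<Rightarrow> 'a \<Rightarrow> 'a" (infixl "\<boxminus>\<index>" 65)
  where "x \<boxminus>\<^bsub>G\<^esub> y \<equiv> x \<otimes>\<^bsub>G\<^esub> inv\<^bsub>G\<^esub> y"

abbreviation (input) gzero :: "('a, 'k) monoid_scheme \<Rightarrow> 'a" ("\<o>\<index>")
  where "\<o>\<^bsub>G\<^esub> \<equiv> \<one>\<^bsub>G\<^esub>"

definition deviation ::
  "('a, 'k) monoid_scheme \<Rightarrow> ('b, 'l) monoid_scheme \<Rightarrow> ('a \<Rightarrow> 'b) \<Rightarrow> 'a \<Rightarrow> 'a \<Rightarrow> 'b"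
  where "deviation M N f m m' = f (m \<boxplus>\<^bsub>M\<^esub> m') \<boxminus>\<^bsub>N\<^esub> f m' \<boxminus>\<^bsub>N\<^esub> f m"


section \<open>Square rings\<close>

text \<open>The record type \<open>ring\<close> only provides the operations of \<open>Re\<close>, which need not form a ring;
  \<open>sact R r s x t\<close> is $(r,s)\cdot x\cdot t$.\<close>

record ('e, 'x) square_ring =
  Re :: "'e ring"
  Ree :: "'x monoid"
  sact :: "'e \<Rightarrow> 'e \<Rightarrow> 'x \<Rightarrow> 'e \<Rightarrow> 'x"
  sT :: "'x \<Rightarrow> 'x"
  sH :: "'e \<Rightarrow> 'x"
  sP :: "'x \<Rightarrow> 'e"

abbreviation lact :: "('e, 'x) square_ring \<Rightarrow> 'e \<Rightarrow> 'e \<Rightarrow> 'x \<Rightarrow> 'x"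
  where "lact R r s x \<equiv> sact R r s x \<one>\<^bsub>Re R\<^esub>"

abbreviation ract :: "('e, 'x) square_ring \<Rightarrow> 'x \<Rightarrow> 'e \<Rightarrow> 'x"
  where "ract R x t \<equiv> sact R \<one>\<^bsub>Re R\<^esub> \<one>\<^bsub>Re R\<^esub> x t"

locale square_ring =
  fixes R :: "('e, 'x) square_ring"
  assumes Re_add_group: "group (add_monoid (Re R))"
    and Re_mult_monoid: "monoid (Re R)"
    and Re_distrib:
      "\<lbrakk>r \<in> carrier (Re R); s \<in> carrier (Re R); t \<in> carrier (Re R)\<rbrakk>
        \<Longrightarrow> r \<otimes>\<^bsub>Re R\<^esub> (s \<oplus>\<^bsub>Re R\<^esub> t) = (r \<otimes>\<^bsub>Re R\<^esub> s) \<oplus>\<^bsub>Re R\<^esub> (r \<otimes>\<^bsub>Re R\<^esub> t)"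
    and Ree_group: "comm_group (Ree R)"
    and sact_closed:
      "\<lbrakk>r \<in> carrier (Re R); s \<in> carrier (Re R); x \<in> carrier (Ree R); t \<in> carrier (Re R)\<rbrakk>
        \<Longrightarrow> sact R r s x t \<in> carrier (Ree R)"
    and sact_add_1:
      "\<lbrakk>r \<in> carrier (Re R); r' \<in> carrier (Re R); s \<in> carrier (Re R);
        x \<in> carrier (Ree R); t \<in> carrier (Re R)\<rbrakk>
        \<Longrightarrow> sact R (r \<oplus>\<^bsub>Re R\<^esub> r') s x t = sact R r s x t \<boxplus>\<^bsub>Ree R\<^esub> sact R r' s x t"
    and sact_add_2:
      "\<lbrakk>r \<in> carrier (Re R); s \<in> carrier (Re R); s' \<in> carrier (Re R);
        x \<in> carrier (Ree R); t \<in> carrier (Re R)\<rbrakk>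
        \<Longrightarrow> sact R r (s \<oplus>\<^bsub>Re R\<^esub> s') x t = sact R r s x t \<boxplus>\<^bsub>Ree R\<^esub> sact R r s' x t"
    and sact_add_3:
      "\<lbrakk>r \<in> carrier (Re R); s \<in> carrier (Re R); x \<in> carrier (Ree R);
        x' \<in> carrier (Ree R); t \<in> carrier (Re R)\<rbrakk>
        \<Longrightarrow> sact R r s (x \<boxplus>\<^bsub>Ree R\<^esub> x') t = sact R r s x t \<boxplus>\<^bsub>Ree R\<^esub> sact R r s x' t"
    and sact_add_4:
      "\<lbrakk>r \<in> carrier (Re R); s \<in> carrier (Re R); x \<in> carrier (Ree R);
        t \<in> carrier (Re R); t' \<in> carrier (Re R)\<rbrakk>
        \<Longrightarrow> sact R r s x (t \<oplus>\<^bsub>Re R\<^esub> t') = sact R r s x t \<boxplus>\<^bsub>Ree R\<^esub> sact R r s x t'"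
    and sact_one: "x \<in> carrier (Ree R) \<Longrightarrow> sact R \<one>\<^bsub>Re R\<^esub> \<one>\<^bsub>Re R\<^esub> x \<one>\<^bsub>Re R\<^esub> = x"
    and lact_lact:
      "\<lbrakk>r \<in> carrier (Re R); r' \<in> carrier (Re R); s \<in> carrier (Re R); s' \<in> carrier (Re R);
        x \<in> carrier (Ree R)\<rbrakk>
        \<Longrightarrow> lact R (r \<otimes>\<^bsub>Re R\<^esub> r') (s \<otimes>\<^bsub>Re R\<^esub> s') x = lact R r s (lact R r' s' x)"
    and ract_ract:
      "\<lbrakk>x \<in> carrier (Ree R); t \<in> carrier (Re R); t' \<in> carrier (Re R)\<rbrakk>
        \<Longrightarrow> ract R x (t \<otimes>\<^bsub>Re R\<^esub> t') = ract R (ract R x t) t'"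
    and ract_lact:
      "\<lbrakk>r \<in> carrier (Re R); s \<in> carrier (Re R); x \<in> carrier (Ree R); t \<in> carrier (Re R)\<rbrakk>
        \<Longrightarrow> ract R (lact R r s x) t = sact R r s x t"
    and lact_ract:
      "\<lbrakk>r \<in> carrier (Re R); s \<in> carrier (Re R); x \<in> carrier (Ree R); t \<in> carrier (Re R)\<rbrakk>
        \<Longrightarrow> lact R r s (ract R x t) = sact R r s x t"
    and T_hom: "sT R \<in> hom (Ree R) (Ree R)"
    and T_T: "x \<in> carrier (Ree R) \<Longrightarrow> sT R (sT R x) = x"
    and H_closed: "r \<in> carrier (Re R) \<Longrightarrow> sH R r \<in> carrier (Ree R)"
    and P_hom: "sP R \<in> hom (Ree R) (add_monoid (Re R))"
    and P_H_P: "x \<in> carrier (Ree R) \<Longrightarrow> sP R (sH R (sP R x)) = sP R x \<oplus>\<^bsub>Re R\<^esub> sP R x"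
    and P_sact:
      "\<lbrakk>r \<in> carrier (Re R); s \<in> carrier (Re R); x \<in> carrier (Ree R)\<rbrakk>
        \<Longrightarrow> sP R (sact R r r x s) = r \<otimes>\<^bsub>Re R\<^esub> sP R x \<otimes>\<^bsub>Re R\<^esub> s"
    and T_eq: "x \<in> carrier (Ree R) \<Longrightarrow> sT R x = sH R (sP R x) \<boxminus>\<^bsub>Ree R\<^esub> x"
    and P_T: "x \<in> carrier (Ree R) \<Longrightarrow> sP R (sT R x) = sP R x"
    and lact_P_1:
      "\<lbrakk>x \<in> carrier (Ree R); r \<in> carrier (Re R); y \<in> carrier (Ree R)\<rbrakk>
        \<Longrightarrow> lact R (sP R x) r y = \<o>\<^bsub>Ree R\<^esub>"
    and lact_P_2:
      "\<lbrakk>x \<in> carrier (Ree R); r \<in> carrier (Re R); y \<in> carrier (Ree R)\<rbrakk>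
        \<Longrightarrow> lact R r (sP R x) y = \<o>\<^bsub>Ree R\<^esub>"
    and ract_P:
      "\<lbrakk>x \<in> carrier (Ree R); y \<in> carrier (Ree R)\<rbrakk> \<Longrightarrow> ract R y (sP R x) = \<o>\<^bsub>Ree R\<^esub>"
    and H_add:
      "\<lbrakk>r \<in> carrier (Re R); s \<in> carrier (Re R)\<rbrakk>
        \<Longrightarrow> sH R (r \<oplus>\<^bsub>Re R\<^esub> s)
            = sH R r \<boxplus>\<^bsub>Ree R\<^esub> sH R s \<boxplus>\<^bsub>Ree R\<^esub> lact R s r (sH R (\<one>\<^bsub>Re R\<^esub> \<oplus>\<^bsub>Re R\<^esub> \<one>\<^bsub>Re R\<^esub>))"
    and H_mult:
      "\<lbrakk>r \<in> carrier (Re R); s \<in> carrier (Re R)\<rbrakk>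
        \<Longrightarrow> sH R (r \<otimes>\<^bsub>Re R\<^esub> s) = lact R r r (sH R s) \<boxplus>\<^bsub>Ree R\<^esub> ract R (sH R r) s"
    and Re_distrib_right:
      "\<lbrakk>r \<in> carrier (Re R); s \<in> carrier (Re R); t \<in> carrier (Re R)\<rbrakk>
        \<Longrightarrow> (r \<oplus>\<^bsub>Re R\<^esub> s) \<otimes>\<^bsub>Re R\<^esub> t
            = (r \<otimes>\<^bsub>Re R\<^esub> t) \<oplus>\<^bsub>Re R\<^esub> (s \<otimes>\<^bsub>Re R\<^esub> t) \<oplus>\<^bsub>Re R\<^esub> sP R (lact R r s (sH R t))"
    and T_sact:
      "\<lbrakk>r \<in> carrier (Re R); s \<in> carrier (Re R); x \<in> carrier (Ree R); t \<in> carrier (Re R)\<rbrakk>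
        \<Longrightarrow> sT R (sact R r s x t) = sact R s r (sT R x) t"

definition square_ring_quotient :: "('e, 'x) square_ring \<Rightarrow> 'e set ring"
  where "square_ring_quotient R = Re R Quot (sP R ` carrier (Ree R))"

locale comm_square_ring = square_ring R for R :: "('e, 'x) square_ring" +
  assumes quotient_comm:
      "\<lbrakk>X \<in> carrier (square_ring_quotient R); Y \<in> carrier (square_ring_quotient R)\<rbrakk>
        \<Longrightarrow> X \<otimes>\<^bsub>square_ring_quotient R\<^esub> Y = Y \<otimes>\<^bsub>square_ring_quotient R\<^esub> X"
    and lact_swap:
      "\<lbrakk>r \<in> carrier (Re R); x \<in> carrier (Ree R)\<rbrakk>
        \<Longrightarrow> lact R r \<one>\<^bsub>Re R\<^esub> x = lact R \<one>\<^bsub>Re R\<^esub> r x"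
    and lact_eq_ract:
      "\<lbrakk>r \<in> carrier (Re R); x \<in> carrier (Ree R)\<rbrakk> \<Longrightarrow> lact R \<one>\<^bsub>Re R\<^esub> r x = ract R x r"


section \<open>BHP-modules and CP-modules\<close>

text \<open>\<open>brk M m n x\<close> is $[m,n]\cdot x$.\<close>

record ('m, 'e, 'x) bhp = "'m monoid" +
  act :: "'m \<Rightarrow> 'e \<Rightarrow> 'm"
  brk :: "'m \<Rightarrow> 'm \<Rightarrow> 'x \<Rightarrow> 'm"

locale bhp_module =
  fixes R :: "('e, 'x) square_ring" and M :: "('m, 'e, 'x) bhp"
  assumes M_group: "group M"
    and act_closed: "\<lbrakk>m \<in> carrier M; r \<in> carrier (Re R)\<rbrakk> \<Longrightarrow> act M m r \<in> carrier M"
    and brk_closed: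
      "\<lbrakk>m \<in> carrier M; n \<in> carrier M; x \<in> carrier (Ree R)\<rbrakk> \<Longrightarrow> brk M m n x \<in> carrier M"
    and act_one: "m \<in> carrier M \<Longrightarrow> act M m \<one>\<^bsub>Re R\<^esub> = m"
    and act_mult:
      "\<lbrakk>m \<in> carrier M; r \<in> carrier (Re R); s \<in> carrier (Re R)\<rbrakk>
        \<Longrightarrow> act M (act M m r) s = act M m (r \<otimes>\<^bsub>Re R\<^esub> s)"
    and act_add:
      "\<lbrakk>m \<in> carrier M; r \<in> carrier (Re R); s \<in> carrier (Re R)\<rbrakk>
        \<Longrightarrow> act M m (r \<oplus>\<^bsub>Re R\<^esub> s) = act M m r \<boxplus>\<^bsub>M\<^esub> act M m s"
    and add_act:
      "\<lbrakk>m \<in> carrier M; n \<in> carrier M; r \<in> carrier (Re R)\<rbrakk>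
        \<Longrightarrow> act M (m \<boxplus>\<^bsub>M\<^esub> n) r = act M m r \<boxplus>\<^bsub>M\<^esub> act M n r \<boxplus>\<^bsub>M\<^esub> brk M m n (sH R r)"
    and act_P:
      "\<lbrakk>m \<in> carrier M; x \<in> carrier (Ree R)\<rbrakk> \<Longrightarrow> act M m (sP R x) = brk M m m x"
    and brk_T:
      "\<lbrakk>m \<in> carrier M; n \<in> carrier M; x \<in> carrier (Ree R)\<rbrakk>
        \<Longrightarrow> brk M m n (sT R x) = brk M n m x"
    and brk_add_1:
      "\<lbrakk>m \<in> carrier M; m' \<in> carrier M; n \<in> carrier M; x \<in> carrier (Ree R)\<rbrakk>
        \<Longrightarrow> brk M (m \<boxplus>\<^bsub>M\<^esub> m') n x = brk M m n x \<boxplus>\<^bsub>M\<^esub> brk M m' n x"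
    and brk_add_2:
      "\<lbrakk>m \<in> carrier M; n \<in> carrier M; n' \<in> carrier M; x \<in> carrier (Ree R)\<rbrakk>
        \<Longrightarrow> brk M m (n \<boxplus>\<^bsub>M\<^esub> n') x = brk M m n x \<boxplus>\<^bsub>M\<^esub> brk M m n' x"
    and brk_add_3:
      "\<lbrakk>m \<in> carrier M; n \<in> carrier M; x \<in> carrier (Ree R); x' \<in> carrier (Ree R)\<rbrakk>
        \<Longrightarrow> brk M m n (x \<boxplus>\<^bsub>Ree R\<^esub> x') = brk M m n x \<boxplus>\<^bsub>M\<^esub> brk M m n x'"
    and brk_act:
      "\<lbrakk>m \<in> carrier M; n \<in> carrier M; r \<in> carrier (Re R); s \<in> carrier (Re R);
        x \<in> carrier (Ree R); t \<in> carrier (Re R)\<rbrakk>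
        \<Longrightarrow> act M (brk M (act M m r) (act M n s) x) t = brk M m n (sact R r s x t)"
    and brk_brk:
      "\<lbrakk>m \<in> carrier M; m' \<in> carrier M; n \<in> carrier M; x \<in> carrier (Ree R); y \<in> carrier (Ree R)\<rbrakk>
        \<Longrightarrow> brk M (brk M m m' x) n y = \<o>\<^bsub>M\<^esub>"

locale cp_module = bhp_module R M
  for R :: "('e, 'x) square_ring" and M :: "('m, 'e, 'x) bhp" +
  fixes A :: "'m set"
  assumes A_subgroup: "subgroup A M"
    and A_act: "\<lbrakk>a \<in> A; r \<in> carrier (Re R)\<rbrakk> \<Longrightarrow> act M a r \<in> A"
    and A_brk: "\<lbrakk>a \<in> A; n \<in> carrier M; x \<in> carrier (Ree R)\<rbrakk> \<Longrightarrow> brk M a n x = \<o>\<^bsub>M\<^esub>"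
    and brk_in_A:
      "\<lbrakk>m \<in> carrier M; n \<in> carrier M; x \<in> carrier (Ree R)\<rbrakk> \<Longrightarrow> brk M m n x \<in> A"


section \<open>Linear, bilinear and CP-quadratic maps\<close>

definition sq_linear ::
  "('e, 'x) square_ring \<Rightarrow> ('m, 'e, 'x) bhp \<Rightarrow> ('n, 'e, 'x) bhp \<Rightarrow> ('m \<Rightarrow> 'n) \<Rightarrow> bool"
  where "sq_linear R M N f \<longleftrightarrow>
    f \<in> hom M N \<and>
    (\<forall>m\<in>carrier M. \<forall>r\<in>carrier (Re R). f (act M m r) = act N (f m) r) \<and>
    (\<forall>m\<in>carrier M. \<forall>m'\<in>carrier M. \<forall>x\<in>carrier (Ree R).
        f (brk M m m' x) = brk N (f m) (f m') x)"

definition sq_bilinear ::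
  "('e, 'x) square_ring \<Rightarrow> ('m, 'e, 'x) bhp \<Rightarrow> ('n, 'e, 'x) bhp \<Rightarrow> ('m \<Rightarrow> 'm \<Rightarrow> 'n) \<Rightarrow> bool"
  where "sq_bilinear R M N b \<longleftrightarrow>
    (\<forall>m\<in>carrier M. sq_linear R M N (\<lambda>m'. b m m')) \<and>
    (\<forall>m'\<in>carrier M. sq_linear R M N (\<lambda>m. b m m'))"

text \<open>The maps $f_{(r)}$ and $f_{[x]}$.\<close>

definition act_defect ::
  "('m, 'e, 'x) bhp \<Rightarrow> ('n, 'e, 'x) bhp \<Rightarrow> ('m \<Rightarrow> 'n) \<Rightarrow> 'e \<Rightarrow> 'm \<Rightarrow> 'n"
  where "act_defect M N f r m = f (act M m r) \<boxminus>\<^bsub>N\<^esub> act N (f m) r"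

definition brk_defect ::
  "('m, 'e, 'x) bhp \<Rightarrow> ('n, 'e, 'x) bhp \<Rightarrow> ('m \<Rightarrow> 'n) \<Rightarrow> 'x \<Rightarrow> 'm \<Rightarrow> 'm \<Rightarrow> 'n"
  where "brk_defect M N f x m m' = f (brk M m m' x) \<boxminus>\<^bsub>N\<^esub> brk N (f m) (f m') x"

text \<open>For a map \<open>g\<close> defined on the set \<open>D\<close>, \<open>sq_Im R N g D\<close> is $\operatorname{Im}_R g$.\<close>

definition sq_Im ::
  "('e, 'x) square_ring \<Rightarrow> ('n, 'e, 'x) bhp \<Rightarrow> ('d \<Rightarrow> 'n) \<Rightarrow> 'd set \<Rightarrow> 'n set"
  where "sq_Im R N g D = \<Inter>{S. subgroup S N \<and> g ` D \<subseteq> S \<and>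
    (\<forall>n\<in>S. \<forall>r\<in>carrier (Re R). act N n r \<in> S) \<and>
    (\<forall>n\<in>S. \<forall>n'\<in>S. \<forall>x\<in>carrier (Ree R). brk N n n' x \<in> S)}"

type_synonym ('m, 'e, 'x) cp_pair = "('m, 'e, 'x) bhp \<times> 'm set"

fun cp_quadratic ::
  "('e, 'x) square_ring \<Rightarrow> ('m, 'e, 'x) cp_pair \<Rightarrow> ('n, 'e, 'x) cp_pair \<Rightarrow> ('m \<Rightarrow> 'n) \<Rightarrow> bool"
  where "cp_quadratic R (M, A) (N, B) f \<longleftrightarrow>
    f \<in> carrier M \<rightarrow> carrier N \<and>
    \<comment> \<open>(1)\<close>
    f ` A \<subseteq> B \<and>
    sq_Im R N (\<lambda>(m, m'). deviation M N f m m') (carrier M \<times> carrier M) \<subseteq> B \<and>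
    (\<forall>r\<in>carrier (Re R). sq_Im R N (act_defect M N f r) (carrier M) \<subseteq> B) \<and>
    (\<forall>x\<in>carrier (Ree R).
        sq_Im R N (\<lambda>(m, m'). brk_defect M N f x m m') (carrier M \<times> carrier M) \<subseteq> B) \<and>
    \<comment> \<open>(2)\<close>
    sq_bilinear R M N (deviation M N f) \<and>
    (\<forall>x\<in>carrier (Ree R). sq_bilinear R M N (brk_defect M N f x)) \<and>
    \<comment> \<open>(3)\<close>
    (\<forall>m\<in>carrier M. \<forall>r\<in>carrier (Re R). \<forall>s\<in>carrier (Re R).
        act_defect M N f r (act M m s) = act N (act_defect M N f r m) (s \<otimes>\<^bsub>Re R\<^esub> s)) \<and>
    \<comment> \<open>(4)\<close>
    (\<forall>m\<in>carrier M. \<forall>a\<in>A. deviation M N f m a = \<o>\<^bsub>N\<^esub> \<and> deviation M N f a m = \<o>\<^bsub>N\<^esub>) \<and>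
    (\<forall>r\<in>carrier (Re R). \<forall>a\<in>A. act_defect M N f r a = \<o>\<^bsub>N\<^esub>) \<and>
    (\<forall>x\<in>carrier (Ree R). \<forall>m\<in>carrier M. \<forall>a\<in>A.
        brk_defect M N f x m a = \<o>\<^bsub>N\<^esub> \<and> brk_defect M N f x a m = \<o>\<^bsub>N\<^esub>)"


section \<open>Categories and functors\<close>

text \<open>Hom-sets need not be disjoint, so identities, composition and the action of a functor
  on morphisms take the objects concerned as arguments: \<open>cmp C X Y Z g f\<close> is the composite of
  \<open>f : X \<rightarrow> Y\<close> followed by \<open>g : Y \<rightarrow> Z\<close>.\<close>

record ('o, 'a) category =
  ob :: "'o set"
  mor :: "'o \<Rightarrow> 'o \<Rightarrow> 'a set"
  idn :: "'o \<Rightarrow> 'a"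
  cmp :: "'o \<Rightarrow> 'o \<Rightarrow> 'o \<Rightarrow> 'a \<Rightarrow> 'a \<Rightarrow> 'a"

locale category =
  fixes C :: "('o, 'a) category"
  assumes idn_in: "X \<in> ob C \<Longrightarrow> idn C X \<in> mor C X X"
    and cmp_in:
      "\<lbrakk>X \<in> ob C; Y \<in> ob C; Z \<in> ob C; f \<in> mor C X Y; g \<in> mor C Y Z\<rbrakk>
        \<Longrightarrow> cmp C X Y Z g f \<in> mor C X Z"
    and idn_left:
      "\<lbrakk>X \<in> ob C; Y \<in> ob C; f \<in> mor C X Y\<rbrakk> \<Longrightarrow> cmp C X Y Y (idn C Y) f = f"
    and idn_right:
      "\<lbrakk>X \<in> ob C; Y \<in> ob C; f \<in> mor C X Y\<rbrakk> \<Longrightarrow> cmp C X X Y f (idn C X) = f"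
    and cmp_assoc:
      "\<lbrakk>W \<in> ob C; X \<in> ob C; Y \<in> ob C; Z \<in> ob C;
        f \<in> mor C W X; g \<in> mor C X Y; h \<in> mor C Y Z\<rbrakk>
        \<Longrightarrow> cmp C W X Z (cmp C X Y Z h g) f = cmp C W Y Z h (cmp C W X Y g f)"

definition op_category :: "('o, 'a) category \<Rightarrow> ('o, 'a) category"
  where "op_category C = \<lparr>
    ob = ob C,
    mor = (\<lambda>X Y. mor C Y X),
    idn = idn C,
    cmp = (\<lambda>X Y Z g f. cmp C Z Y X f g)\<rparr>"

definition prod_category ::
  "('o, 'a) category \<Rightarrow> ('p, 'b) category \<Rightarrow> ('o \<times> 'p, 'a \<times> 'b) category"
  where "prod_category C D = \<lparr>
    ob = ob C \<times> ob D,
    mor = (\<lambda>X Y. mor C (fst X) (fst Y) \<times> mor D (snd X) (snd Y)),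
    idn = (\<lambda>X. (idn C (fst X), idn D (snd X))),
    cmp = (\<lambda>X Y Z g f. (cmp C (fst X) (fst Y) (fst Z) (fst g) (fst f),
                        cmp D (snd X) (snd Y) (snd Z) (snd g) (snd f)))\<rparr>"

locale cat_functor = C: category C + D: category D
  for C :: "('o, 'a) category" and D :: "('p, 'b) category" +
  fixes Fo :: "'o \<Rightarrow> 'p" and Fm :: "'o \<Rightarrow> 'o \<Rightarrow> 'a \<Rightarrow> 'b"
  assumes F_ob: "X \<in> ob C \<Longrightarrow> Fo X \<in> ob D"
    and F_mor:
      "\<lbrakk>X \<in> ob C; Y \<in> ob C; f \<in> mor C X Y\<rbrakk> \<Longrightarrow> Fm X Y f \<in> mor D (Fo X) (Fo Y)"
    and F_idn: "X \<in> ob C \<Longrightarrow> Fm X X (idn C X) = idn D (Fo X)"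
    and F_cmp:
      "\<lbrakk>X \<in> ob C; Y \<in> ob C; Z \<in> ob C; f \<in> mor C X Y; g \<in> mor C Y Z\<rbrakk>
        \<Longrightarrow> Fm X Z (cmp C X Y Z g f) = cmp D (Fo X) (Fo Y) (Fo Z) (Fm Y Z g) (Fm X Y f)"

definition quadratic_map ::
  "('a, 'k) monoid_scheme \<Rightarrow> ('b, 'l) monoid_scheme \<Rightarrow> ('a \<Rightarrow> 'b) \<Rightarrow> bool"
  where "quadratic_map G H q \<longleftrightarrow>
    q \<in> carrier G \<rightarrow> carrier H \<and>
    (\<forall>y\<in>carrier G. (\<lambda>x. deviation G H q x y) \<in> hom G H) \<and>
    (\<forall>x\<in>carrier G. (\<lambda>y. deviation G H q x y) \<in> hom G H)"

locale prequadratic_right = category C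
  for C :: "('o, 'a) category" +
  fixes HG :: "'o \<Rightarrow> 'o \<Rightarrow> 'a monoid"
  assumes HG_group: "\<lbrakk>X \<in> ob C; Y \<in> ob C\<rbrakk> \<Longrightarrow> group (HG X Y)"
    and HG_carrier: "\<lbrakk>X \<in> ob C; Y \<in> ob C\<rbrakk> \<Longrightarrow> carrier (HG X Y) = mor C X Y"
    and precomp_hom:
      "\<lbrakk>X \<in> ob C; Y \<in> ob C; Z \<in> ob C; f \<in> mor C X Y\<rbrakk>
        \<Longrightarrow> (\<lambda>g. cmp C X Y Z g f) \<in> hom (HG Y Z) (HG X Z)"
    and postcomp_quadratic:
      "\<lbrakk>X \<in> ob C; Y \<in> ob C; Z \<in> ob C; g \<in> mor C Y Z\<rbrakk>
        \<Longrightarrow> quadratic_map (HG X Y) (HG X Z) (\<lambda>f. cmp C X Y Z g f)"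


section \<open>The category of CP-modules and its internal Hom\<close>

text \<open>Morphisms are represented by functions that are \<^const>\<open>undefined\<close> outside the carrier of
  their source, so that a morphism is determined by its values.  The type \<open>'m\<close> plays the role
  of the universe in which the underlying sets live.\<close>

fun cp_maps ::
  "('e, 'x) square_ring \<Rightarrow> ('m, 'e, 'x) cp_pair \<Rightarrow> ('n, 'e, 'x) cp_pair \<Rightarrow> ('m \<Rightarrow> 'n) set"
  where "cp_maps R (M, A) (N, B) =
    {f \<in> carrier M \<rightarrow>\<^sub>E carrier N. cp_quadratic R (M, A) (N, B) f}"

definition CP_category ::
  "('e, 'x) square_ring \<Rightarrow> (('m, 'e, 'x) cp_pair, 'm \<Rightarrow> 'm) category"
  where "CP_category R = \<lparr>
    ob = {(M, A). cp_module R M A},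
    mor = cp_maps R,
    idn = (\<lambda>(M, A). \<lambda>m\<in>carrier M. m),
    cmp = (\<lambda>(M, A) _ _ g f. compose (carrier M) g f)\<rparr>"

fun cp_hom_group ::
  "('e, 'x) square_ring \<Rightarrow> ('m, 'e, 'x) cp_pair \<Rightarrow> ('n, 'e, 'x) cp_pair \<Rightarrow> ('m \<Rightarrow> 'n) monoid"
  where "cp_hom_group R (M, A) (N, B) = \<lparr>
    carrier = cp_maps R (M, A) (N, B),
    monoid.mult = (\<lambda>f g. \<lambda>m\<in>carrier M. f m \<boxplus>\<^bsub>N\<^esub> g m),
    one = (\<lambda>m\<in>carrier M. \<o>\<^bsub>N\<^esub>)\<rparr>"

fun cp_hom_bhp ::
  "('e, 'x) square_ring \<Rightarrow> ('m, 'e, 'x) cp_pair \<Rightarrow> ('n, 'e, 'x) cp_pair \<Rightarrow> ('m \<Rightarrow> 'n, 'e, 'x) bhp"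
  where "cp_hom_bhp R (M, A) (N, B) = \<lparr>
    carrier = cp_maps R (M, A) (N, B),
    monoid.mult = (\<lambda>f g. \<lambda>m\<in>carrier M. f m \<boxplus>\<^bsub>N\<^esub> g m),
    one = (\<lambda>m\<in>carrier M. \<o>\<^bsub>N\<^esub>),
    act = (\<lambda>f r. \<lambda>m\<in>carrier M. act N (f m) r),
    brk = (\<lambda>f g x. \<lambda>m\<in>carrier M. brk N (f m) (g m) x)\<rparr>"

text \<open>The second member of the internal Hom consists of the CP-quadratic maps
  $(M,A)\to(B,0)$.  Here $(M,A)\to(B,0)$ qualifies a CP-quadratic map of $(M,A)$ to $(N,B)$ as a
  map of pairs: it sends \<open>M\<close> into \<open>B\<close> and \<open>A\<close> to \<open>0\<close>.  Requiring instead CP-quadraticity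
  with respect to the CP-module $(B,0)$ would force these maps to be linear, and postcomposition
  would then not act on internal Homs: over the integers ($R_{ee}=0$), the CP-quadratic map
  $g(m)=m^2$ from $(\mathbf Z,0)$ to $(\mathbf Z,\mathbf Z)$ gives
  $d_{g_*}(\mathrm{id},\mathrm{id})(m)=2m^2$, which is not linear.\<close>

fun cp_hom ::
  "('e, 'x) square_ring \<Rightarrow> ('m, 'e, 'x) cp_pair \<Rightarrow> ('n, 'e, 'x) cp_pair \<Rightarrow> ('m \<Rightarrow> 'n, 'e, 'x) cp_pair"
  where "cp_hom R (M, A) (N, B) =
    (cp_hom_bhp R (M, A) (N, B),
     {f \<in> cp_maps R (M, A) (N, B). f ` carrier M \<subseteq> B \<and> f ` A \<subseteq> {\<o>\<^bsub>N\<^esub>}})"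

definition internal_Hom_ob ::
  "('e, 'x) square_ring \<Rightarrow> ('m, 'e, 'x) cp_pair \<times> ('n, 'e, 'x) cp_pair \<Rightarrow> ('m \<Rightarrow> 'n, 'e, 'x) cp_pair"
  where "internal_Hom_ob R = (\<lambda>(X, Y). cp_hom R X Y)"

definition internal_Hom_mor ::
  "('e, 'x) square_ring
    \<Rightarrow> ('m, 'e, 'x) cp_pair \<times> ('n, 'e, 'x) cp_pair \<Rightarrow> ('m, 'e, 'x) cp_pair \<times> ('n, 'e, 'x) cp_pair
    \<Rightarrow> ('m \<Rightarrow> 'm) \<times> ('n \<Rightarrow> 'n) \<Rightarrow> ('m \<Rightarrow> 'n) \<Rightarrow> ('m \<Rightarrow> 'n)"
  where "internal_Hom_mor R = (\<lambda>(X, Y) (X', Y') (f, g). \<lambda>h\<in>cp_maps R X Y.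
    compose (carrier (fst X')) g (compose (carrier (fst X')) h f))"

end

theory Submission
  imports Defs
begin

text \<open>Computing $(m+n)\cdot 2$ in two ways gives $n+m=m+n+[m,n]\cdot H(2)$, so in a CP-module
  $(N,B)$ the subgroup $B$ is central, and on $B$ the action is additive and factors through the
  commutative ring $\overline R$.  A map $f$ is CP-quadratic exactly when $f(A)\subseteq B$ and
  $f(m+m')$, $f(m\cdot r)$, $f([m,m']\cdot x)$ differ from $f(m)+f(m')$, $f(m)\cdot r$,
  $[f(m),f(m')]\cdot x$ by $B$-valued forms that are bilinear, quadratic in scalars and bilinear,
  respectively, and vanish on $A$.  Such forms are closed under sums and scalars and include
  $[f(m),g(m')]\cdot x$ for CP-quadratic $f,g$, and the defects of $f+g$, $f\cdot r$,
  $[f,g]\cdot x$ and $g\circ f$ are combinations of them.  The defects of $h\mapsto g\circ h\circ f$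
  are computed pointwise from those of $g$, which yields functoriality of the internal Hom and, for
  $f=\mathrm{id}$, the quadraticity of postcomposition.\<close>

section \<open>Square rings\<close>

text \<open>The obstacle is that the groups need not be commutative: rearranging
  \<open>f(m) + f(n) + g(m) + g(n)\<close> for a pointwise sum already produces a commutator. It is
  harmless because it is a bracket of values of \<open>f\<close> and \<open>g\<close>, and a bracket
  sees a CP-quadratic map as if it were additive and compatible with scalars: the corrections lie in
  \<open>B\<close>, and brackets kill \<open>B\<close>. The error terms created by rearranging are
  therefore again forms with values in \<open>B\<close>. Vanishing of the defects on the
  distinguished subgroup is what lets the error terms of an inner map pass additively through an
  outer one. Accordingly the identities carry the error term on the left, as a single central
  summand. Noncommutativity of the multiplication of \<open>R_e\<close> shows up when a map is
  multiplied by a scalar: \<open>s r\<close> and \<open>r s\<close> differ by some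
  \<open>P(y)\<close>, which acts as \<open>m \<mapsto> [m,m] \<cdot> y\<close>, once more of degree
  two in \<open>m\<close>.\<close>

context square_ring
begin

lemma Re_mult_closed [simp]:
  "\<lbrakk>r \<in> carrier (Re R); s \<in> carrier (Re R)\<rbrakk> \<Longrightarrow> r \<otimes>\<^bsub>Re R\<^esub> s \<in> carrier (Re R)"
  using monoid.m_closed[OF Re_mult_monoid] by blast

lemma Re_one_closed [simp]: "\<one>\<^bsub>Re R\<^esub> \<in> carrier (Re R)"
  using monoid.one_closed[OF Re_mult_monoid] by blast

lemma Re_add_closed [simp]:
  "\<lbrakk>r \<in> carrier (Re R); s \<in> carrier (Re R)\<rbrakk> \<Longrightarrow> r \<oplus>\<^bsub>Re R\<^esub> s \<in> carrier (Re R)"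
  using monoid.m_closed[OF group.is_monoid[OF Re_add_group]] by simp

lemma Re_zero_closed [simp]: "\<zero>\<^bsub>Re R\<^esub> \<in> carrier (Re R)"
  using monoid.one_closed[OF group.is_monoid[OF Re_add_group]] by simp

lemma Re_add_assoc:
  "\<lbrakk>r \<in> carrier (Re R); s \<in> carrier (Re R); t \<in> carrier (Re R)\<rbrakk>
    \<Longrightarrow> r \<oplus>\<^bsub>Re R\<^esub> s \<oplus>\<^bsub>Re R\<^esub> t = r \<oplus>\<^bsub>Re R\<^esub> (s \<oplus>\<^bsub>Re R\<^esub> t)"
  using monoid.m_assoc[OF group.is_monoid[OF Re_add_group]] by simp

lemma Re_zero_add: "r \<in> carrier (Re R) \<Longrightarrow> \<zero>\<^bsub>Re R\<^esub> \<oplus>\<^bsub>Re R\<^esub> r = r"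
  using monoid.l_one[OF group.is_monoid[OF Re_add_group]] by simp

lemma Re_minus_closed [simp]: "r \<in> carrier (Re R) \<Longrightarrow> \<ominus>\<^bsub>Re R\<^esub> r \<in> carrier (Re R)"
  using group.inv_closed[OF Re_add_group] by (simp add: a_inv_def)

lemma Re_minus_add: "r \<in> carrier (Re R) \<Longrightarrow> \<ominus>\<^bsub>Re R\<^esub> r \<oplus>\<^bsub>Re R\<^esub> r = \<zero>\<^bsub>Re R\<^esub>"
  using group.l_inv[OF Re_add_group] by (simp add: a_inv_def)

lemma P_closed [simp]: "x \<in> carrier (Ree R) \<Longrightarrow> sP R x \<in> carrier (Re R)"
  using P_hom by (auto simp: hom_def)

lemma P_add:
  "\<lbrakk>x \<in> carrier (Ree R); y \<in> carrier (Ree R)\<rbrakk>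
    \<Longrightarrow> sP R (x \<otimes>\<^bsub>Ree R\<^esub> y) = sP R x \<oplus>\<^bsub>Re R\<^esub> sP R y"
  using P_hom by (auto simp: hom_def)

lemma P_zero: "sP R \<one>\<^bsub>Ree R\<^esub> = \<zero>\<^bsub>Re R\<^esub>"
  using hom_one[OF P_hom comm_group.axioms(2)[OF Ree_group] Re_add_group] by simp

lemma T_closed [simp]: "x \<in> carrier (Ree R) \<Longrightarrow> sT R x \<in> carrier (Ree R)"
  using T_hom by (auto simp: hom_def)

lemma Ree_add_closed [simp]:
  "\<lbrakk>x \<in> carrier (Ree R); y \<in> carrier (Ree R)\<rbrakk> \<Longrightarrow> x \<otimes>\<^bsub>Ree R\<^esub> y \<in> carrier (Ree R)"
  by (rule monoid.m_closed[OF group.is_monoid[OF comm_group.axioms(2)[OF Ree_group]]])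

lemma Ree_zero_closed [simp]: "\<one>\<^bsub>Ree R\<^esub> \<in> carrier (Ree R)"
  by (rule monoid.one_closed[OF group.is_monoid[OF comm_group.axioms(2)[OF Ree_group]]])

lemmas [simp] = H_closed sact_closed

end

section \<open>Commutativity of the scalars modulo the image of \<open>P\<close>\<close>

context comm_square_ring
begin

text \<open>Membership of \<open>r s\<close> in a product of cosets is carried across
  \<open>quotient_comm\<close>, which gives \<open>r s = P(x) + (P(u) + s)(P(v) + r)\<close>;
  expanding the product collects all values of \<open>P\<close> to the left of \<open>s r\<close>.
  An explicit \<open>y\<close> is wanted, rather than an equality of cosets, because on a module
  \<open>P(y)\<close> acts through a bracket, by \<open>act_P\<close>.\<close>

lemma mult_comm_mod_P:
  assumes r: "r \<in> carrier (Re R)" and s: "s \<in> carrier (Re R)"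
  obtains y where "y \<in> carrier (Ree R)"
    "r \<otimes>\<^bsub>Re R\<^esub> s = sP R y \<oplus>\<^bsub>Re R\<^esub> s \<otimes>\<^bsub>Re R\<^esub> r"
proof -
  define I where "I = sP R ` carrier (Ree R)"
  have coset: "I +>\<^bsub>Re R\<^esub> t = {sP R x \<oplus>\<^bsub>Re R\<^esub> t | x. x \<in> carrier (Ree R)}" for t
    by (auto simp: I_def a_r_coset_def')
  have self: "t \<in> I +>\<^bsub>Re R\<^esub> t" if "t \<in> carrier (Re R)" for t
    unfolding coset using P_zero Re_zero_add[OF that] Ree_zero_closed by (metis (mono_tags, lifting) mem_Collect_eq)
  have carr: "I +>\<^bsub>Re R\<^esub> t \<in> carrier (square_ring_quotient R)" if "t \<in> carrier (Re R)" for t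
    using that by (auto simp: square_ring_quotient_def FactRing_def A_RCOSETS_def' I_def)
  have mult: "X \<otimes>\<^bsub>square_ring_quotient R\<^esub> Y = (\<Union>a\<in>X. \<Union>b\<in>Y. I +>\<^bsub>Re R\<^esub> (a \<otimes>\<^bsub>Re R\<^esub> b))" for X Y
    by (simp add: square_ring_quotient_def FactRing_def rcoset_mult_def I_def)
  have "r \<otimes>\<^bsub>Re R\<^esub> s \<in> (I +>\<^bsub>Re R\<^esub> r) \<otimes>\<^bsub>square_ring_quotient R\<^esub> (I +>\<^bsub>Re R\<^esub> s)"
    unfolding mult by (intro UN_I[OF self[OF r]] UN_I[OF self[OF s]] self Re_mult_closed r s)
  then have "r \<otimes>\<^bsub>Re R\<^esub> s \<in> (I +>\<^bsub>Re R\<^esub> s) \<otimes>\<^bsub>square_ring_quotient R\<^esub> (I +>\<^bsub>Re R\<^esub> r)"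
    using quotient_comm[OF carr[OF r] carr[OF s]] by simp
  then obtain x u v where x: "x \<in> carrier (Ree R)" and u: "u \<in> carrier (Ree R)"
      and v: "v \<in> carrier (Ree R)"
      and eq: "r \<otimes>\<^bsub>Re R\<^esub> s
        = sP R x \<oplus>\<^bsub>Re R\<^esub> (sP R u \<oplus>\<^bsub>Re R\<^esub> s) \<otimes>\<^bsub>Re R\<^esub> (sP R v \<oplus>\<^bsub>Re R\<^esub> r)"
    unfolding mult UN_iff coset mem_Collect_eq by blast
  let ?w = "sP R u \<oplus>\<^bsub>Re R\<^esub> s"
  have w: "?w \<in> carrier (Re R)" using u s by simp
  \<comment> \<open>\<open>P_sact\<close> needs the same left scalar twice, so the whole factor
    \<open>P(u) + s\<close> is kept together here instead of being distributed.\<close>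
  have wv: "?w \<otimes>\<^bsub>Re R\<^esub> sP R v = sP R (sact R ?w ?w v \<one>\<^bsub>Re R\<^esub>)"
    using P_sact[OF w Re_one_closed v] w v monoid.r_one[OF Re_mult_monoid] by simp
  have ur: "sP R u \<otimes>\<^bsub>Re R\<^esub> r = sP R (sact R \<one>\<^bsub>Re R\<^esub> \<one>\<^bsub>Re R\<^esub> u r)"
    using P_sact[OF Re_one_closed r u] r u monoid.l_one[OF Re_mult_monoid] by simp
  \<comment> \<open>The correction term of right distributivity vanishes, as its left factor is in the image of P.\<close>
  have "lact R (sP R u) s (sH R r) = \<one>\<^bsub>Ree R\<^esub>" by (rule lact_P_1[OF u s H_closed[OF r]])
  then have wr: "?w \<otimes>\<^bsub>Re R\<^esub> r = sP R (sact R \<one>\<^bsub>Re R\<^esub> \<one>\<^bsub>Re R\<^esub> u r) \<oplus>\<^bsub>Re R\<^esub> s \<otimes>\<^bsub>Re R\<^esub> r"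
    using Re_distrib_right[OF P_closed[OF u] s r] ur u s r P_zero
      group.is_monoid[OF Re_add_group, THEN monoid.r_one] by simp
  have "r \<otimes>\<^bsub>Re R\<^esub> s = sP R (x \<otimes>\<^bsub>Ree R\<^esub> (sact R ?w ?w v \<one>\<^bsub>Re R\<^esub> \<otimes>\<^bsub>Ree R\<^esub>
      sact R \<one>\<^bsub>Re R\<^esub> \<one>\<^bsub>Re R\<^esub> u r)) \<oplus>\<^bsub>Re R\<^esub> s \<otimes>\<^bsub>Re R\<^esub> r"
    using eq Re_distrib[OF w P_closed[OF v] r] wv wr x u v r s w by (simp add: P_add Re_add_assoc)
  then show thesis by (rule that[rotated]) (intro Ree_add_closed sact_closed Re_one_closed x u v w r)
qed

lemma lact_eq_ract': "\<lbrakk>r \<in> carrier (Re R); x \<in> carrier (Ree R)\<rbrakk> \<Longrightarrow> lact R r \<one>\<^bsub>Re R\<^esub> x = ract R x r"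
  by (rule trans[OF lact_swap lact_eq_ract])

end

section \<open>CP-modules\<close>

sublocale bhp_module \<subseteq> group M
  by (rule M_group)

locale comm_cp_module = comm_square_ring R + cp_module R M A
  for R :: "('e, 'x) square_ring" and M :: "('m, 'e, 'x) bhp" and A :: "'m set"
begin

lemmas [simp] = act_closed brk_closed A_brk brk_in_A A_act

lemma A_carrier [simp]: "a \<in> A \<Longrightarrow> a \<in> carrier M"
  using A_subgroup by (meson subgroup.mem_carrier)

lemma A_add [simp]: "\<lbrakk>a \<in> A; b \<in> A\<rbrakk> \<Longrightarrow> a \<otimes>\<^bsub>M\<^esub> b \<in> A"
  using A_subgroup by (meson subgroup.m_closed)

lemma A_zero [simp]: "\<one>\<^bsub>M\<^esub> \<in> A"
  using A_subgroup by (meson subgroup.one_closed)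

text \<open>The axiom \<open>A_brk\<close> treats the first slot; \<open>T\<close> exchanges the two
  slots.\<close>

lemma brk_A [simp]:
  "\<lbrakk>n \<in> carrier M; a \<in> A; x \<in> carrier (Ree R)\<rbrakk> \<Longrightarrow> brk M n a x = \<one>\<^bsub>M\<^esub>"
  using brk_T[of a n x] by simp

lemma A_add_act:
  "\<lbrakk>a \<in> A; n \<in> carrier M; r \<in> carrier (Re R)\<rbrakk>
    \<Longrightarrow> act M (a \<otimes>\<^bsub>M\<^esub> n) r = act M a r \<otimes>\<^bsub>M\<^esub> act M n r"
  using add_act[of a n r] by simp

lemma zero_act [simp]: "r \<in> carrier (Re R) \<Longrightarrow> act M \<one>\<^bsub>M\<^esub> r = \<one>\<^bsub>M\<^esub>"
  using A_add_act[of "\<one>\<^bsub>M\<^esub>" "\<one>\<^bsub>M\<^esub>" r] by simp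

lemma act_zero: "m \<in> carrier M \<Longrightarrow> act M m \<zero>\<^bsub>Re R\<^esub> = \<one>\<^bsub>M\<^esub>"
  using act_add[of m "\<zero>\<^bsub>Re R\<^esub>" "\<zero>\<^bsub>Re R\<^esub>"] Re_zero_add[of "\<zero>\<^bsub>Re R\<^esub>"] by simp

text \<open>Additivity in the scalar gives \<open>m \<cdot> (-1) + m = m \<cdot> 0 = 0\<close>. This
  turns closure of forms and of CP-quadratic maps under negation into a case of closure under
  scalars.\<close>

lemma act_minus_one: "m \<in> carrier M \<Longrightarrow> act M m (\<ominus>\<^bsub>Re R\<^esub> \<one>\<^bsub>Re R\<^esub>) = inv\<^bsub>M\<^esub> m"
  using act_add[of m "\<ominus>\<^bsub>Re R\<^esub> \<one>\<^bsub>Re R\<^esub>" "\<one>\<^bsub>Re R\<^esub>"] Re_minus_add[of "\<one>\<^bsub>Re R\<^esub>"]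
  by (simp add: act_zero act_one inv_equality)

text \<open>Both sides compute \<open>(m + n) \<cdot> 2\<close>, once by additivity in the scalar and once by \<open>add_act\<close>.\<close>

lemma add_two_eq:
  assumes "m \<in> carrier M" "n \<in> carrier M"
  shows "n \<otimes>\<^bsub>M\<^esub> (m \<otimes>\<^bsub>M\<^esub> n)
    = m \<otimes>\<^bsub>M\<^esub> (n \<otimes>\<^bsub>M\<^esub> (n \<otimes>\<^bsub>M\<^esub> brk M m n (sH R (\<one>\<^bsub>Re R\<^esub> \<oplus>\<^bsub>Re R\<^esub> \<one>\<^bsub>Re R\<^esub>))))"
proof -
  have two: "act M k (\<one>\<^bsub>Re R\<^esub> \<oplus>\<^bsub>Re R\<^esub> \<one>\<^bsub>Re R\<^esub>) = k \<otimes>\<^bsub>M\<^esub> k" if "k \<in> carrier M" for k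
    using that by (simp add: act_add act_one)
  show ?thesis
    using add_act[of m n "\<one>\<^bsub>Re R\<^esub> \<oplus>\<^bsub>Re R\<^esub> \<one>\<^bsub>Re R\<^esub>"] assms by (simp add: two m_assoc)
qed

lemma A_central:
  assumes "a \<in> A" "n \<in> carrier M"
  shows "n \<otimes>\<^bsub>M\<^esub> a = a \<otimes>\<^bsub>M\<^esub> n"
proof -
  have "(n \<otimes>\<^bsub>M\<^esub> a) \<otimes>\<^bsub>M\<^esub> n = (a \<otimes>\<^bsub>M\<^esub> n) \<otimes>\<^bsub>M\<^esub> n"
    using add_two_eq[of a n] assms by (simp add: m_assoc)
  then show ?thesis using assms by simp
qed

lemma A_left_commute:
  "\<lbrakk>a \<in> A; n \<in> carrier M; k \<in> carrier M\<rbrakk> \<Longrightarrow> n \<otimes>\<^bsub>M\<^esub> (a \<otimes>\<^bsub>M\<^esub> k) = a \<otimes>\<^bsub>M\<^esub> (n \<otimes>\<^bsub>M\<^esub> k)"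
  using A_central[of a n] by (simp flip: m_assoc)

text \<open>The usual interchange of a sum of two sums, with centrality required of one inner term
  only. This is what allows an error term to be moved past an arbitrary value of a map.\<close>

lemma A_add_interchange:
  assumes "b \<in> A" "m \<in> carrier M" "n \<in> carrier M" "k \<in> carrier M"
  shows "(m \<otimes>\<^bsub>M\<^esub> n) \<otimes>\<^bsub>M\<^esub> (b \<otimes>\<^bsub>M\<^esub> k) = (m \<otimes>\<^bsub>M\<^esub> b) \<otimes>\<^bsub>M\<^esub> (n \<otimes>\<^bsub>M\<^esub> k)"
  using assms A_left_commute[of b n k] by (simp add: m_assoc)

lemma A_inv [simp]: "a \<in> A \<Longrightarrow> inv\<^bsub>M\<^esub> a \<in> A"
  using A_subgroup by (meson subgroup.m_inv_closed)

lemma cancel_middle: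
  assumes "m \<in> carrier M" "n \<in> carrier M" "k \<in> carrier M"
  shows "(m \<otimes>\<^bsub>M\<^esub> inv\<^bsub>M\<^esub> n) \<otimes>\<^bsub>M\<^esub> (n \<otimes>\<^bsub>M\<^esub> k) = m \<otimes>\<^bsub>M\<^esub> k"
  using assms inv_solve_left[of k n "n \<otimes>\<^bsub>M\<^esub> k"] by (simp add: m_assoc)

text \<open>Both sides of \<open>add_two_eq\<close> end in \<open>n\<close> up to the bracket; the
  bracket lies in \<open>A\<close>, so it can be moved to the front before that \<open>n\<close> is
  cancelled. Centrality of \<open>A\<close> is thus needed before the general commutator
  formula.\<close>

lemma add_commutator:
  assumes "m \<in> carrier M" "n \<in> carrier M"
  shows "n \<otimes>\<^bsub>M\<^esub> m = brk M m n (sH R (\<one>\<^bsub>Re R\<^esub> \<oplus>\<^bsub>Re R\<^esub> \<one>\<^bsub>Re R\<^esub>)) \<otimes>\<^bsub>M\<^esub> (m \<otimes>\<^bsub>M\<^esub> n)"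
proof -
  let ?c = "brk M m n (sH R (\<one>\<^bsub>Re R\<^esub> \<oplus>\<^bsub>Re R\<^esub> \<one>\<^bsub>Re R\<^esub>))"
  have c: "?c \<in> A" using assms by simp
  have "(n \<otimes>\<^bsub>M\<^esub> m) \<otimes>\<^bsub>M\<^esub> n = (?c \<otimes>\<^bsub>M\<^esub> (m \<otimes>\<^bsub>M\<^esub> n)) \<otimes>\<^bsub>M\<^esub> n"
    using add_two_eq[OF assms] A_central[OF c, of n] A_left_commute[OF c] assms c by (simp add: m_assoc)
  then show ?thesis using assms by simp
qed

lemma brk_ract:
  "\<lbrakk>m \<in> carrier M; n \<in> carrier M; x \<in> carrier (Ree R); r \<in> carrier (Re R)\<rbrakk>
    \<Longrightarrow> brk M m n (ract R x r) = act M (brk M m n x) r"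
  using brk_act[of m n "\<one>\<^bsub>Re R\<^esub>" "\<one>\<^bsub>Re R\<^esub>" x r] by (simp add: act_one)

text \<open>Here the identity \<open>(r,1) \<cdot> x = x \<cdot> r\<close> of a commutative square
  ring enters: it lets a scalar leave either slot and act on the value of the bracket.\<close>

lemma brk_act_1:
  "\<lbrakk>m \<in> carrier M; n \<in> carrier M; x \<in> carrier (Ree R); r \<in> carrier (Re R)\<rbrakk>
    \<Longrightarrow> brk M (act M m r) n x = act M (brk M m n x) r"
  using brk_act[of m n r "\<one>\<^bsub>Re R\<^esub>" x "\<one>\<^bsub>Re R\<^esub>"]
  by (simp add: act_one lact_eq_ract' brk_ract)

lemma brk_act_2:
  "\<lbrakk>m \<in> carrier M; n \<in> carrier M; x \<in> carrier (Ree R); r \<in> carrier (Re R)\<rbrakk>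
    \<Longrightarrow> brk M m (act M n r) x = act M (brk M m n x) r"
  using brk_act[of m n "\<one>\<^bsub>Re R\<^esub>" r x "\<one>\<^bsub>Re R\<^esub>"]
  by (simp add: act_one lact_eq_ract brk_ract)

text \<open>The discrepancy \<open>a \<cdot> P(y)\<close> equals \<open>[a,a] \<cdot> y\<close>,
  which is zero for \<open>a\<close> in \<open>A\<close>.\<close>

lemma act_A_commute:
  assumes "a \<in> A" "r \<in> carrier (Re R)" "s \<in> carrier (Re R)"
  shows "act M (act M a r) s = act M (act M a s) r"
proof -
  obtain y where "y \<in> carrier (Ree R)" "r \<otimes>\<^bsub>Re R\<^esub> s = sP R y \<oplus>\<^bsub>Re R\<^esub> s \<otimes>\<^bsub>Re R\<^esub> r"
    using mult_comm_mod_P assms by metis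
  then show ?thesis using assms by (simp add: act_mult act_add act_P)
qed

text \<open>\<open>A\<close> is itself a subgroup stable under scalars and brackets, so as soon as
  it contains the image of \<open>g\<close> it belongs to the family whose intersection is
  \<open>sq_Im\<close>.\<close>

lemma sq_Im_subset_iff:
  assumes "g ` D \<subseteq> carrier M"
  shows "sq_Im R M g D \<subseteq> A \<longleftrightarrow> g ` D \<subseteq> A"
proof
  assume "g ` D \<subseteq> A"
  then show "sq_Im R M g D \<subseteq> A"
    unfolding sq_Im_def by (intro Inter_lower) (auto simp: A_subgroup)
next
  assume "sq_Im R M g D \<subseteq> A"
  moreover have "g ` D \<subseteq> sq_Im R M g D" unfolding sq_Im_def by blast
  ultimately show "g ` D \<subseteq> A" by blast
qed

end


section \<open>CP-quadratic maps\<close>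

declare cp_quadratic.simps [simp del] cp_maps.simps [simp del] cp_hom_bhp.simps [simp del]
  cp_hom_group.simps [simp del] cp_hom.simps [simp del]

text \<open>In this setting compatibility with brackets holds by vanishing: a bracket in one
  argument lies in \<open>A\<close>, where the form is zero, and a bracket of two values lies in
  \<open>[B,B]\<close>, which is zero. This is how the definition matches \<open>sq_bilinear\<close>
  in \<open>sq_bilinear_iff\<close>.\<close>

definition cp_bilinear ::
  "('e, 'x) square_ring \<Rightarrow> ('m, 'e, 'x) bhp \<Rightarrow> 'm set \<Rightarrow> ('n, 'e, 'x) bhp \<Rightarrow> 'n set
    \<Rightarrow> ('m \<Rightarrow> 'm \<Rightarrow> 'n) \<Rightarrow> bool"
  where "cp_bilinear R M A N B b \<longleftrightarrow>
    (\<forall>m\<in>carrier M. \<forall>n\<in>carrier M. b m n \<in> B) \<and>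
    (\<forall>m\<in>carrier M. \<forall>m'\<in>carrier M. \<forall>n\<in>carrier M.
      b (m \<otimes>\<^bsub>M\<^esub> m') n = b m n \<otimes>\<^bsub>N\<^esub> b m' n \<and> b n (m \<otimes>\<^bsub>M\<^esub> m') = b n m \<otimes>\<^bsub>N\<^esub> b n m') \<and>
    (\<forall>m\<in>carrier M. \<forall>n\<in>carrier M. \<forall>r\<in>carrier (Re R).
      b (act M m r) n = act N (b m n) r \<and> b m (act M n r) = act N (b m n) r) \<and>
    (\<forall>m\<in>carrier M. \<forall>a\<in>A. b m a = \<one>\<^bsub>N\<^esub> \<and> b a m = \<one>\<^bsub>N\<^esub>)"

text \<open>This records homogeneity of degree two in the scalars and says nothing about
  \<open>q(m + m')\<close>. The model is \<open>m \<mapsto> [f(m), g(m)] \<cdot> x\<close>, see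
  \<open>sqform_brk\<close>.\<close>

definition cp_square_form ::
  "('e, 'x) square_ring \<Rightarrow> ('m, 'e, 'x) bhp \<Rightarrow> 'm set \<Rightarrow> ('n, 'e, 'x) bhp \<Rightarrow> 'n set
    \<Rightarrow> ('m \<Rightarrow> 'n) \<Rightarrow> bool"
  where "cp_square_form R M A N B q \<longleftrightarrow>
    (\<forall>m\<in>carrier M. q m \<in> B) \<and>
    (\<forall>m\<in>carrier M. \<forall>s\<in>carrier (Re R). q (act M m s) = act N (q m) (s \<otimes>\<^bsub>Re R\<^esub> s)) \<and>
    (\<forall>a\<in>A. q a = \<one>\<^bsub>N\<^esub>)"

lemma cp_bilinear_D:
  assumes "cp_bilinear R M A N B b"
  shows "\<And>m n. \<lbrakk>m \<in> carrier M; n \<in> carrier M\<rbrakk> \<Longrightarrow> b m n \<in> B"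
    and "\<And>m m' n. \<lbrakk>m \<in> carrier M; m' \<in> carrier M; n \<in> carrier M\<rbrakk>
      \<Longrightarrow> b (m \<otimes>\<^bsub>M\<^esub> m') n = b m n \<otimes>\<^bsub>N\<^esub> b m' n"
    and "\<And>m m' n. \<lbrakk>m \<in> carrier M; m' \<in> carrier M; n \<in> carrier M\<rbrakk>
      \<Longrightarrow> b n (m \<otimes>\<^bsub>M\<^esub> m') = b n m \<otimes>\<^bsub>N\<^esub> b n m'"
    and "\<And>m n r. \<lbrakk>m \<in> carrier M; n \<in> carrier M; r \<in> carrier (Re R)\<rbrakk>
      \<Longrightarrow> b (act M m r) n = act N (b m n) r"
    and "\<And>m n r. \<lbrakk>m \<in> carrier M; n \<in> carrier M; r \<in> carrier (Re R)\<rbrakk>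
      \<Longrightarrow> b m (act M n r) = act N (b m n) r"
    and "\<And>m a. \<lbrakk>m \<in> carrier M; a \<in> A\<rbrakk> \<Longrightarrow> b m a = \<one>\<^bsub>N\<^esub>"
    and "\<And>m a. \<lbrakk>m \<in> carrier M; a \<in> A\<rbrakk> \<Longrightarrow> b a m = \<one>\<^bsub>N\<^esub>"
  using assms by (auto simp: cp_bilinear_def)

lemma cp_square_form_D:
  assumes "cp_square_form R M A N B q"
  shows "\<And>m. m \<in> carrier M \<Longrightarrow> q m \<in> B"
    and "\<And>m s. \<lbrakk>m \<in> carrier M; s \<in> carrier (Re R)\<rbrakk>
      \<Longrightarrow> q (act M m s) = act N (q m) (s \<otimes>\<^bsub>Re R\<^esub> s)"
    and "\<And>a. a \<in> A \<Longrightarrow> q a = \<one>\<^bsub>N\<^esub>"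
  using assms by (auto simp: cp_square_form_def)

locale cp_module_pair = M: comm_cp_module R M A + N: comm_cp_module R N B
  for R :: "('e, 'x) square_ring"
    and M :: "('m, 'e, 'x) bhp" and A :: "'m set"
    and N :: "('n, 'e, 'x) bhp" and B :: "'n set"
begin

abbreviation bilin :: "('m \<Rightarrow> 'm \<Rightarrow> 'n) \<Rightarrow> bool"
  where "bilin \<equiv> cp_bilinear R M A N B"

abbreviation sqform :: "('m \<Rightarrow> 'n) \<Rightarrow> bool"
  where "sqform \<equiv> cp_square_form R M A N B"

abbreviation quadratic :: "('m \<Rightarrow> 'n) \<Rightarrow> bool"
  where "quadratic \<equiv> cp_quadratic R (M, A) (N, B)"

lemma sq_bilinear_iff:
  assumes "\<And>m n. \<lbrakk>m \<in> carrier M; n \<in> carrier M\<rbrakk> \<Longrightarrow> b m n \<in> B"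
    and "\<And>m a. \<lbrakk>m \<in> carrier M; a \<in> A\<rbrakk> \<Longrightarrow> b m a = \<one>\<^bsub>N\<^esub>"
    and "\<And>m a. \<lbrakk>m \<in> carrier M; a \<in> A\<rbrakk> \<Longrightarrow> b a m = \<one>\<^bsub>N\<^esub>"
  shows "sq_bilinear R M N b \<longleftrightarrow> bilin b"
  using assms by (auto simp: sq_bilinear_def sq_linear_def cp_bilinear_def hom_def)

lemma bilin_cong:
  assumes "\<And>m n. \<lbrakk>m \<in> carrier M; n \<in> carrier M\<rbrakk> \<Longrightarrow> b m n = c m n"
  shows "bilin b \<longleftrightarrow> bilin c"
  using assms by (simp add: cp_bilinear_def)

lemma sqform_cong:
  assumes "\<And>m. m \<in> carrier M \<Longrightarrow> p m = q m"
  shows "sqform p \<longleftrightarrow> sqform q"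
  using assms by (simp add: cp_square_form_def)

lemma deviation_closed:
  "\<lbrakk>f \<in> carrier M \<rightarrow> carrier N; m \<in> carrier M; n \<in> carrier M\<rbrakk> \<Longrightarrow> deviation M N f m n \<in> carrier N"
  by (auto simp: deviation_def intro!: N.m_closed N.inv_closed)

lemma act_defect_closed:
  "\<lbrakk>f \<in> carrier M \<rightarrow> carrier N; m \<in> carrier M; r \<in> carrier (Re R)\<rbrakk>
    \<Longrightarrow> act_defect M N f r m \<in> carrier N"
  by (auto simp: act_defect_def intro!: N.m_closed N.inv_closed N.act_closed)

lemma brk_defect_closed:
  "\<lbrakk>f \<in> carrier M \<rightarrow> carrier N; m \<in> carrier M; n \<in> carrier M; x \<in> carrier (Ree R)\<rbrakk>
    \<Longrightarrow> brk_defect M N f x m n \<in> carrier N"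
  by (auto simp: brk_defect_def intro!: N.m_closed N.inv_closed N.brk_closed)

text \<open>By \<open>sq_Im_subset_iff\<close> the conditions on generated submodules become
  statements about values, and the vanishing conditions on \<open>A\<close> are regrouped with the
  defect they concern.\<close>

lemma quadratic_iff:
  "quadratic f \<longleftrightarrow>
    f \<in> carrier M \<rightarrow> carrier N \<and> f ` A \<subseteq> B \<and> bilin (deviation M N f) \<and>
    (\<forall>r\<in>carrier (Re R). sqform (act_defect M N f r)) \<and>
    (\<forall>x\<in>carrier (Ree R). bilin (brk_defect M N f x))"
proof (cases "f \<in> carrier M \<rightarrow> carrier N")
  case True
  have dev: "sq_Im R N (\<lambda>(m, m'). deviation M N f m m') (carrier M \<times> carrier M) \<subseteq> B \<longleftrightarrow>
      (\<forall>m\<in>carrier M. \<forall>n\<in>carrier M. deviation M N f m n \<in> B)"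
    using deviation_closed[OF True] by (subst N.sq_Im_subset_iff) auto
  have act: "sq_Im R N (act_defect M N f r) (carrier M) \<subseteq> B \<longleftrightarrow>
      (\<forall>m\<in>carrier M. act_defect M N f r m \<in> B)" if "r \<in> carrier (Re R)" for r
    using act_defect_closed[OF True _ that] by (subst N.sq_Im_subset_iff) auto
  have brk: "sq_Im R N (\<lambda>(m, m'). brk_defect M N f x m m') (carrier M \<times> carrier M) \<subseteq> B \<longleftrightarrow>
      (\<forall>m\<in>carrier M. \<forall>n\<in>carrier M. brk_defect M N f x m n \<in> B)" if "x \<in> carrier (Ree R)" for x
  proof -
    have "(\<lambda>(m, m'). brk_defect M N f x m m') ` (carrier M \<times> carrier M) \<subseteq> carrier N"
      using brk_defect_closed[OF True _ _ that] by (simp add: image_subset_iff)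
    from N.sq_Im_subset_iff[OF this] show ?thesis by (simp add: image_subset_iff)
  qed
  \<comment> \<open>Homogeneity of the scalar defects quantifies over \<open>m\<close> before
    \<open>r\<close>, whereas a square form belongs to a fixed \<open>r\<close>.\<close>
  have swap: "(\<forall>m\<in>carrier M. \<forall>r\<in>carrier (Re R). Q m r) \<longleftrightarrow>
      (\<forall>r\<in>carrier (Re R). \<forall>m\<in>carrier M. Q m r)" for Q
    by blast
  have bilin_iff: "bilin b \<longleftrightarrow> (\<forall>m\<in>carrier M. \<forall>n\<in>carrier M. b m n \<in> B) \<and>
      (\<forall>m\<in>carrier M. \<forall>a\<in>A. b m a = \<one>\<^bsub>N\<^esub> \<and> b a m = \<one>\<^bsub>N\<^esub>) \<and> sq_bilinear R M N b" for b
    using sq_bilinear_iff[of b] by (auto simp: cp_bilinear_def)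
  show ?thesis
    unfolding bilin_iff cp_square_form_def cp_quadratic.simps dev ball_conj_distrib
    by (simp add: True act brk ball_conj_distrib swap
        cong: conj_cong) (intro iffI; elim conjE; intro conjI; assumption)
qed (simp add: cp_quadratic.simps)

text \<open>An error term standing on the left is determined by its equation: cancelling on the
  right, in the order in which \<open>deviation\<close> subtracts, recovers the defect. So any forms
  satisfying the equations will do, and they may be found by calculation with the values of
  \<open>f\<close>.\<close>

lemma quadraticI:
  assumes f: "\<And>m. m \<in> carrier M \<Longrightarrow> f m \<in> carrier N" and fA: "\<And>a. a \<in> A \<Longrightarrow> f a \<in> B"
    and b: "bilin b"
    and add: "\<And>m n. \<lbrakk>m \<in> carrier M; n \<in> carrier M\<rbrakk>
      \<Longrightarrow> f (m \<otimes>\<^bsub>M\<^esub> n) = b m n \<otimes>\<^bsub>N\<^esub> (f m \<otimes>\<^bsub>N\<^esub> f n)"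
    and act: "\<And>r. r \<in> carrier (Re R) \<Longrightarrow>
      \<exists>q. sqform q \<and> (\<forall>m\<in>carrier M. f (act M m r) = q m \<otimes>\<^bsub>N\<^esub> act N (f m) r)"
    and brk: "\<And>x. x \<in> carrier (Ree R) \<Longrightarrow>
      \<exists>c. bilin c \<and> (\<forall>m\<in>carrier M. \<forall>n\<in>carrier M. f (brk M m n x) = c m n \<otimes>\<^bsub>N\<^esub> brk N (f m) (f n) x)"
  shows "quadratic f"
proof -
  have "bilin (deviation M N f)"
    using b f by (subst bilin_cong[of _ b])
      (auto simp: deviation_def add N.m_assoc cp_bilinear_D(1)[OF b])
  moreover have "sqform (act_defect M N f r)" if r: "r \<in> carrier (Re R)" for r
  proof -
    obtain q where q: "sqform q" and eq: "\<forall>m\<in>carrier M. f (act M m r) = q m \<otimes>\<^bsub>N\<^esub> act N (f m) r"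
      using act[OF r] by blast
    then show ?thesis using f r by (subst sqform_cong[of _ q])
      (auto simp: act_defect_def N.m_assoc cp_square_form_D(1)[OF q])
  qed
  moreover have "bilin (brk_defect M N f x)" if x: "x \<in> carrier (Ree R)" for x
  proof -
    obtain c where c: "bilin c" and
      eq: "\<forall>m\<in>carrier M. \<forall>n\<in>carrier M. f (brk M m n x) = c m n \<otimes>\<^bsub>N\<^esub> brk N (f m) (f n) x"
      using brk[OF x] by blast
    then show ?thesis using f x by (subst bilin_cong[of _ c])
      (auto simp: brk_defect_def N.m_assoc cp_bilinear_D(1)[OF c])
  qed
  ultimately show ?thesis using f fA by (auto simp: quadratic_iff)
qed

lemma quadraticD:
  assumes "quadratic f"
  shows "\<And>m. m \<in> carrier M \<Longrightarrow> f m \<in> carrier N" and "\<And>a. a \<in> A \<Longrightarrow> f a \<in> B"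
    and "bilin (deviation M N f)"
    and "\<And>r. r \<in> carrier (Re R) \<Longrightarrow> sqform (act_defect M N f r)"
    and "\<And>x. x \<in> carrier (Ree R) \<Longrightarrow> bilin (brk_defect M N f x)"
  using assms by (auto simp: quadratic_iff)

lemma
  assumes f: "quadratic f"
  shows quadratic_add: "\<And>m n. \<lbrakk>m \<in> carrier M; n \<in> carrier M\<rbrakk>
      \<Longrightarrow> f (m \<otimes>\<^bsub>M\<^esub> n) = deviation M N f m n \<otimes>\<^bsub>N\<^esub> (f m \<otimes>\<^bsub>N\<^esub> f n)"
    and quadratic_act: "\<And>m r. \<lbrakk>m \<in> carrier M; r \<in> carrier (Re R)\<rbrakk>
      \<Longrightarrow> f (act M m r) = act_defect M N f r m \<otimes>\<^bsub>N\<^esub> act N (f m) r"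
    and quadratic_brk: "\<And>m n x. \<lbrakk>m \<in> carrier M; n \<in> carrier M; x \<in> carrier (Ree R)\<rbrakk>
      \<Longrightarrow> f (brk M m n x) = brk_defect M N f x m n \<otimes>\<^bsub>N\<^esub> brk N (f m) (f n) x"
proof -
  note [simp] = quadraticD(1)[OF f]
  show "f (m \<otimes>\<^bsub>M\<^esub> n) = deviation M N f m n \<otimes>\<^bsub>N\<^esub> (f m \<otimes>\<^bsub>N\<^esub> f n)"
    if "m \<in> carrier M" "n \<in> carrier M" for m n
  proof -
    have "inv\<^bsub>N\<^esub> f m \<otimes>\<^bsub>N\<^esub> (f m \<otimes>\<^bsub>N\<^esub> f n) = f n" using that by (simp flip: N.m_assoc)
    then show ?thesis using that by (simp add: deviation_def N.m_assoc)
  qed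
  show "f (act M m r) = act_defect M N f r m \<otimes>\<^bsub>N\<^esub> act N (f m) r"
    if "m \<in> carrier M" "r \<in> carrier (Re R)" for m r
    using that by (simp add: act_defect_def N.m_assoc)
  show "f (brk M m n x) = brk_defect M N f x m n \<otimes>\<^bsub>N\<^esub> brk N (f m) (f n) x"
    if "m \<in> carrier M" "n \<in> carrier M" "x \<in> carrier (Ree R)" for m n x
    using that by (simp add: brk_defect_def N.m_assoc)
qed

text \<open>The operations stay inside the carrier, so \<open>g\<close> satisfies the same equations
  with the forms of \<open>f\<close>. This permits passing to the restricted functions that
  represent morphisms.\<close>

lemma quadratic_cong:
  assumes "quadratic f" "\<And>m. m \<in> carrier M \<Longrightarrow> g m = f m"
  shows "quadratic g"
proof (rule quadraticI[of g "deviation M N f"])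
  note D = quadraticD[OF assms(1)]
  show "\<exists>q. sqform q \<and> (\<forall>m\<in>carrier M. g (act M m r) = q m \<otimes>\<^bsub>N\<^esub> act N (g m) r)"
    if "r \<in> carrier (Re R)" for r
    using that assms(2) D(4)[OF that] quadratic_act[OF assms(1)] by (intro exI[of _ "act_defect M N f r"]) simp
  show "\<exists>c. bilin c \<and> (\<forall>m\<in>carrier M. \<forall>n\<in>carrier M. g (brk M m n x) = c m n \<otimes>\<^bsub>N\<^esub> brk N (g m) (g n) x)"
    if "x \<in> carrier (Ree R)" for x
    using that assms(2) D(5)[OF that] quadratic_brk[OF assms(1)] by (intro exI[of _ "brk_defect M N f x"]) simp
qed (simp_all add: assms(2) quadraticD[OF assms(1)] quadratic_add[OF assms(1)])

section \<open>Closure properties of forms with values in \<open>B\<close>\<close>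

lemma bilin_add: "\<lbrakk>bilin b; bilin c\<rbrakk> \<Longrightarrow> bilin (\<lambda>m n. b m n \<otimes>\<^bsub>N\<^esub> c m n)"
  by (simp add: cp_bilinear_def N.A_add_interchange N.A_add_act)

text \<open>Additivity survives because \<open>r\<close> acts additively on \<open>B\<close>,
  compatibility with scalars because the actions of two scalars on \<open>B\<close> commute.\<close>

lemma bilin_act: "\<lbrakk>bilin b; r \<in> carrier (Re R)\<rbrakk> \<Longrightarrow> bilin (\<lambda>m n. act N (b m n) r)"
  by (simp add: cp_bilinear_def N.A_add_act N.act_A_commute[of _ r])

lemma bilin_inv: "bilin b \<Longrightarrow> bilin (\<lambda>m n. inv\<^bsub>N\<^esub> b m n)"
  by (rule iffD1[OF bilin_cong bilin_act[of b "\<ominus>\<^bsub>Re R\<^esub> \<one>\<^bsub>Re R\<^esub>"]])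
    (simp_all add: N.act_minus_one cp_bilinear_D(1)[of R M A N B b])

lemma bilin_zero: "bilin (\<lambda>m n. \<one>\<^bsub>N\<^esub>)"
  by (simp add: cp_bilinear_def)

lemma sqform_add: "\<lbrakk>sqform p; sqform q\<rbrakk> \<Longrightarrow> sqform (\<lambda>m. p m \<otimes>\<^bsub>N\<^esub> q m)"
  by (simp add: cp_square_form_def N.A_add_act)

lemma sqform_act: "\<lbrakk>sqform q; r \<in> carrier (Re R)\<rbrakk> \<Longrightarrow> sqform (\<lambda>m. act N (q m) r)"
  by (simp add: cp_square_form_def N.act_A_commute[of _ r])

lemma sqform_inv: "sqform q \<Longrightarrow> sqform (\<lambda>m. inv\<^bsub>N\<^esub> q m)"
  by (rule iffD1[OF sqform_cong sqform_act[of q "\<ominus>\<^bsub>Re R\<^esub> \<one>\<^bsub>Re R\<^esub>"]])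
    (simp_all add: N.act_minus_one cp_square_form_D(1)[of R M A N B q])

text \<open>Although \<open>f\<close> is neither additive nor compatible with scalars, its bracket
  with a fixed element is: the defects of \<open>f\<close> lie in \<open>B\<close> and disappear
  inside the bracket.\<close>

lemma
  assumes f: "quadratic f" and n: "n \<in> carrier N" and x: "x \<in> carrier (Ree R)"
  shows brk_quadratic_add_1: "\<lbrakk>m \<in> carrier M; m' \<in> carrier M\<rbrakk>
      \<Longrightarrow> brk N (f (m \<otimes>\<^bsub>M\<^esub> m')) n x = brk N (f m) n x \<otimes>\<^bsub>N\<^esub> brk N (f m') n x"
    and brk_quadratic_add_2: "\<lbrakk>m \<in> carrier M; m' \<in> carrier M\<rbrakk>
      \<Longrightarrow> brk N n (f (m \<otimes>\<^bsub>M\<^esub> m')) x = brk N n (f m) x \<otimes>\<^bsub>N\<^esub> brk N n (f m') x"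
    and brk_quadratic_act_1: "\<lbrakk>m \<in> carrier M; r \<in> carrier (Re R)\<rbrakk>
      \<Longrightarrow> brk N (f (act M m r)) n x = act N (brk N (f m) n x) r"
    and brk_quadratic_act_2: "\<lbrakk>m \<in> carrier M; r \<in> carrier (Re R)\<rbrakk>
      \<Longrightarrow> brk N n (f (act M m r)) x = act N (brk N n (f m) x) r"
  using quadraticD(1)[OF f] cp_bilinear_D(1)[OF quadraticD(3)[OF f]]
    cp_square_form_D(1)[OF quadraticD(4)[OF f]] n x
  by (simp_all add: quadratic_add[OF f] quadratic_act[OF f] N.brk_add_1 N.brk_add_2
      N.brk_act_1 N.brk_act_2)

lemma bilin_brk:
  assumes f: "quadratic f" and g: "quadratic g" and x: "x \<in> carrier (Ree R)"
  shows "bilin (\<lambda>m n. brk N (f m) (g n) x)"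
  using x quadraticD(1,2)[OF f] quadraticD(1,2)[OF g]
  by (simp add: cp_bilinear_def brk_quadratic_add_1[OF f] brk_quadratic_add_2[OF g]
      brk_quadratic_act_1[OF f] brk_quadratic_act_2[OF g])

lemma sqform_brk:
  assumes f: "quadratic f" and g: "quadratic g" and x: "x \<in> carrier (Ree R)"
  shows "sqform (\<lambda>m. brk N (f m) (g m) x)"
  using x quadraticD(1,2)[OF f] quadraticD(1,2)[OF g]
  by (simp add: cp_square_form_def brk_quadratic_act_1[OF f] brk_quadratic_act_2[OF g] N.act_mult)

section \<open>Pointwise operations on CP-quadratic maps\<close>

lemma quadratic_pointwise_add:
  assumes f: "quadratic f" and g: "quadratic g"
  shows "quadratic (\<lambda>m. f m \<otimes>\<^bsub>N\<^esub> g m)"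
proof -
  let ?h2 = "sH R (\<one>\<^bsub>Re R\<^esub> \<oplus>\<^bsub>Re R\<^esub> \<one>\<^bsub>Re R\<^esub>)"
  note [simp] = quadraticD(1,2)[OF f] quadraticD(1,2)[OF g]
  let ?df = "deviation M N f" and ?dg = "deviation M N g"
  \<comment> \<open>The third summand is the cost of exchanging \<open>f n\<close> and
    \<open>g m\<close> in the middle of \<open>f m + f n + g m + g n\<close>.\<close>
  have bd: "bilin (\<lambda>m n. (?df m n \<otimes>\<^bsub>N\<^esub> ?dg m n) \<otimes>\<^bsub>N\<^esub> brk N (g m) (f n) ?h2)"
    by (intro bilin_add bilin_brk f g quadraticD(3)) simp
  show ?thesis
  proof (rule quadraticI[OF _ _ bd])
    fix m n assume m [simp]: "m \<in> carrier M" and n [simp]: "n \<in> carrier M"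
    let ?k = "brk N (g m) (f n) ?h2"
    have [simp]: "?df m n \<in> B" "?dg m n \<in> B" "?k \<in> B"
      using cp_bilinear_D(1)[OF quadraticD(3)] f g by simp_all
    have "(f m \<otimes>\<^bsub>N\<^esub> f n) \<otimes>\<^bsub>N\<^esub> (g m \<otimes>\<^bsub>N\<^esub> g n) = f m \<otimes>\<^bsub>N\<^esub> ((f n \<otimes>\<^bsub>N\<^esub> g m) \<otimes>\<^bsub>N\<^esub> g n)"
      by (simp add: N.m_assoc)
    also have "\<dots> = ?k \<otimes>\<^bsub>N\<^esub> ((f m \<otimes>\<^bsub>N\<^esub> g m) \<otimes>\<^bsub>N\<^esub> (f n \<otimes>\<^bsub>N\<^esub> g n))"
      by (simp add: N.add_commutator[of "g m" "f n"] N.m_assoc N.A_left_commute[of ?k])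
    finally have "(f m \<otimes>\<^bsub>N\<^esub> f n) \<otimes>\<^bsub>N\<^esub> (g m \<otimes>\<^bsub>N\<^esub> g n)
        = ?k \<otimes>\<^bsub>N\<^esub> ((f m \<otimes>\<^bsub>N\<^esub> g m) \<otimes>\<^bsub>N\<^esub> (f n \<otimes>\<^bsub>N\<^esub> g n))" .
    then show "f (m \<otimes>\<^bsub>M\<^esub> n) \<otimes>\<^bsub>N\<^esub> g (m \<otimes>\<^bsub>M\<^esub> n)
        = (?df m n \<otimes>\<^bsub>N\<^esub> ?dg m n) \<otimes>\<^bsub>N\<^esub> ?k \<otimes>\<^bsub>N\<^esub> ((f m \<otimes>\<^bsub>N\<^esub> g m) \<otimes>\<^bsub>N\<^esub> (f n \<otimes>\<^bsub>N\<^esub> g n))"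
      using N.A_add_interchange[of "?dg m n" "?df m n" "f m \<otimes>\<^bsub>N\<^esub> f n" "g m \<otimes>\<^bsub>N\<^esub> g n"]
      by (simp add: quadratic_add[OF f] quadratic_add[OF g] N.m_assoc)
  next
    fix r assume r [simp]: "r \<in> carrier (Re R)"
    \<comment> \<open>The bracket is subtracted because \<open>add_act\<close> makes it appear in
      \<open>(f m + g m) \<cdot> r\<close>, while the left side of the desired equation does not
      contain it.\<close>
    let ?q = "\<lambda>m. (act_defect M N f r m \<otimes>\<^bsub>N\<^esub> act_defect M N g r m)
      \<otimes>\<^bsub>N\<^esub> inv\<^bsub>N\<^esub> brk N (f m) (g m) (sH R r)"
    have "sqform ?q" by (intro sqform_add sqform_inv sqform_brk quadraticD(4) f g) simp_all
    moreover have "f (act M m r) \<otimes>\<^bsub>N\<^esub> g (act M m r) = ?q m \<otimes>\<^bsub>N\<^esub> act N (f m \<otimes>\<^bsub>N\<^esub> g m) r"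
      if m [simp]: "m \<in> carrier M" for m
    proof -
      let ?k = "brk N (f m) (g m) (sH R r)" and ?p = "act_defect M N f r m"
        and ?q = "act_defect M N g r m" and ?x = "act N (f m) r" and ?y = "act N (g m) r"
      have [simp]: "?p \<in> B" "?q \<in> B" "?k \<in> B"
        using cp_square_form_D(1)[OF quadraticD(4)] f g by simp_all
      have "(?p \<otimes>\<^bsub>N\<^esub> ?x) \<otimes>\<^bsub>N\<^esub> (?q \<otimes>\<^bsub>N\<^esub> ?y) = (?p \<otimes>\<^bsub>N\<^esub> ?q) \<otimes>\<^bsub>N\<^esub> (?x \<otimes>\<^bsub>N\<^esub> ?y)"
        by (rule N.A_add_interchange) simp_all
      also have "\<dots> = ((?p \<otimes>\<^bsub>N\<^esub> ?q) \<otimes>\<^bsub>N\<^esub> inv\<^bsub>N\<^esub> ?k) \<otimes>\<^bsub>N\<^esub> (?k \<otimes>\<^bsub>N\<^esub> (?x \<otimes>\<^bsub>N\<^esub> ?y))"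
        by (simp add: N.cancel_middle)
      finally show ?thesis
        using N.A_central[of ?k "?x \<otimes>\<^bsub>N\<^esub> ?y"]
        by (simp add: quadratic_act[OF f] quadratic_act[OF g] N.add_act)
    qed
    ultimately show "\<exists>q. sqform q \<and> (\<forall>m\<in>carrier M. f (act M m r) \<otimes>\<^bsub>N\<^esub> g (act M m r)
        = q m \<otimes>\<^bsub>N\<^esub> act N (f m \<otimes>\<^bsub>N\<^esub> g m) r)" by blast
  next
    fix x assume x [simp]: "x \<in> carrier (Ree R)"
    \<comment> \<open>What is subtracted are the two cross terms in the expansion of
      \<open>[f m + g m, f n + g n] \<cdot> x\<close>.\<close>
    let ?c = "\<lambda>m n. (brk_defect M N f x m n \<otimes>\<^bsub>N\<^esub> brk_defect M N g x m n)
      \<otimes>\<^bsub>N\<^esub> inv\<^bsub>N\<^esub> (brk N (f m) (g n) x \<otimes>\<^bsub>N\<^esub> brk N (g m) (f n) x)"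
    have "bilin ?c" by (intro bilin_add bilin_inv bilin_brk quadraticD(5) f g x)
    moreover have "f (brk M m n x) \<otimes>\<^bsub>N\<^esub> g (brk M m n x)
        = ?c m n \<otimes>\<^bsub>N\<^esub> brk N (f m \<otimes>\<^bsub>N\<^esub> g m) (f n \<otimes>\<^bsub>N\<^esub> g n) x"
      if m [simp]: "m \<in> carrier M" and n [simp]: "n \<in> carrier M" for m n
    proof -
      let ?p = "brk_defect M N f x m n" and ?q = "brk_defect M N g x m n"
        and ?u = "brk N (f m) (g n) x" and ?v = "brk N (g m) (f n) x"
        and ?y = "brk N (f m) (f n) x" and ?z = "brk N (g m) (g n) x"
      have [simp]: "?p \<in> B" "?q \<in> B"
        using cp_bilinear_D(1)[OF quadraticD(5)] f g by simp_all
      have uv: "?u \<otimes>\<^bsub>N\<^esub> ?v \<in> B" by simp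
      have "brk N (f m \<otimes>\<^bsub>N\<^esub> g m) (f n \<otimes>\<^bsub>N\<^esub> g n) x = (?y \<otimes>\<^bsub>N\<^esub> ?v) \<otimes>\<^bsub>N\<^esub> (?u \<otimes>\<^bsub>N\<^esub> ?z)"
        by (simp add: N.brk_add_1 N.brk_add_2)
      also have "\<dots> = (?u \<otimes>\<^bsub>N\<^esub> ?v) \<otimes>\<^bsub>N\<^esub> (?y \<otimes>\<^bsub>N\<^esub> ?z)"
        using N.A_central[of ?y ?u] N.A_add_interchange[of ?u ?y ?v ?z]
          N.A_add_interchange[of ?y ?u ?v ?z] by simp
      finally have eq: "brk N (f m \<otimes>\<^bsub>N\<^esub> g m) (f n \<otimes>\<^bsub>N\<^esub> g n) x
        = (?u \<otimes>\<^bsub>N\<^esub> ?v) \<otimes>\<^bsub>N\<^esub> (?y \<otimes>\<^bsub>N\<^esub> ?z)" .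
      have "(?p \<otimes>\<^bsub>N\<^esub> ?y) \<otimes>\<^bsub>N\<^esub> (?q \<otimes>\<^bsub>N\<^esub> ?z) = (?p \<otimes>\<^bsub>N\<^esub> ?q) \<otimes>\<^bsub>N\<^esub> (?y \<otimes>\<^bsub>N\<^esub> ?z)"
        by (rule N.A_add_interchange) simp_all
      also have "\<dots> = ((?p \<otimes>\<^bsub>N\<^esub> ?q) \<otimes>\<^bsub>N\<^esub> inv\<^bsub>N\<^esub> (?u \<otimes>\<^bsub>N\<^esub> ?v)) \<otimes>\<^bsub>N\<^esub> ((?u \<otimes>\<^bsub>N\<^esub> ?v) \<otimes>\<^bsub>N\<^esub> (?y \<otimes>\<^bsub>N\<^esub> ?z))"
        using N.cancel_middle[OF _ N.A_carrier[OF uv]] by simp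
      finally show ?thesis by (simp add: quadratic_brk[OF f] quadratic_brk[OF g] eq)
    qed
    ultimately show "\<exists>c. bilin c \<and> (\<forall>m\<in>carrier M. \<forall>n\<in>carrier M.
        f (brk M m n x) \<otimes>\<^bsub>N\<^esub> g (brk M m n x) = c m n \<otimes>\<^bsub>N\<^esub> brk N (f m \<otimes>\<^bsub>N\<^esub> g m) (f n \<otimes>\<^bsub>N\<^esub> g n) x)"
      by blast
  qed simp_all
qed

lemma quadratic_pointwise_act:
  assumes f: "quadratic f" and r [simp]: "r \<in> carrier (Re R)"
  shows "quadratic (\<lambda>m. act N (f m) r)"
proof -
  note [simp] = quadraticD(1,2)[OF f]
  have bd: "bilin (\<lambda>m n. act N (deviation M N f m n) r \<otimes>\<^bsub>N\<^esub> brk N (f m) (f n) (sH R r))"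
    by (intro bilin_add bilin_act bilin_brk f quadraticD(3)) simp_all
  show ?thesis
  proof (rule quadraticI[OF _ _ bd])
    fix m n assume m [simp]: "m \<in> carrier M" and n [simp]: "n \<in> carrier M"
    have [simp]: "deviation M N f m n \<in> B" using cp_bilinear_D(1)[OF quadraticD(3)[OF f]] by simp
    let ?k = "brk N (f m) (f n) (sH R r)"
    have k: "?k \<in> B" by simp
    show "act N (f (m \<otimes>\<^bsub>M\<^esub> n)) r = act N (deviation M N f m n) r \<otimes>\<^bsub>N\<^esub> ?k
        \<otimes>\<^bsub>N\<^esub> (act N (f m) r \<otimes>\<^bsub>N\<^esub> act N (f n) r)"
      using N.A_central[OF k, of "act N (f m) r \<otimes>\<^bsub>N\<^esub> act N (f n) r"]
      by (simp add: quadratic_add[OF f] N.A_add_act N.add_act N.m_assoc)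
  next
    fix s assume s [simp]: "s \<in> carrier (Re R)"
    \<comment> \<open>The two scalars must be exchanged: \<open>f(m \<cdot> s) \<cdot> r\<close>
      involves \<open>s r\<close>, the target involves \<open>r s\<close>. On \<open>f m\<close>,
      which need not lie in \<open>B\<close>, the difference \<open>P(y)\<close> contributes the
      square form \<open>[f m, f m] \<cdot> y\<close>.\<close>
    obtain y where y [simp]: "y \<in> carrier (Ree R)"
        and sr: "s \<otimes>\<^bsub>Re R\<^esub> r = sP R y \<oplus>\<^bsub>Re R\<^esub> r \<otimes>\<^bsub>Re R\<^esub> s"
      using M.mult_comm_mod_P[OF s r] .
    let ?q = "\<lambda>m. act N (act_defect M N f s m) r \<otimes>\<^bsub>N\<^esub> brk N (f m) (f m) y"
    have "sqform ?q" by (intro sqform_add sqform_act sqform_brk quadraticD(4) f) simp_all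
    moreover have "act N (f (act M m s)) r = ?q m \<otimes>\<^bsub>N\<^esub> act N (act N (f m) r) s"
      if m [simp]: "m \<in> carrier M" for m
    proof -
      have [simp]: "act_defect M N f s m \<in> B"
        using cp_square_form_D(1)[OF quadraticD(4)[OF f]] by simp
      show ?thesis
        by (simp add: quadratic_act[OF f] N.A_add_act N.act_mult sr N.act_add N.act_P N.m_assoc)
    qed
    ultimately show "\<exists>q. sqform q \<and> (\<forall>m\<in>carrier M. act N (f (act M m s)) r
        = q m \<otimes>\<^bsub>N\<^esub> act N (act N (f m) r) s)" by blast
  next
    fix x assume x [simp]: "x \<in> carrier (Ree R)"
    let ?k = "\<lambda>m n. brk N (f m) (f n) x"
    \<comment> \<open>Bracketing \<open>f m \<cdot> r\<close> with \<open>f n \<cdot> r\<close>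
      brings out \<open>r\<close> twice, whereas acting on the bracket afterwards brings it out
      once; the last two summands make up the difference.\<close>
    let ?c = "\<lambda>m n. act N (brk_defect M N f x m n) r
      \<otimes>\<^bsub>N\<^esub> (act N (?k m n) r \<otimes>\<^bsub>N\<^esub> inv\<^bsub>N\<^esub> act N (act N (?k m n) r) r)"
    have "bilin ?c" by (intro bilin_add bilin_act bilin_inv bilin_brk quadraticD(5) f x r)
    moreover have "act N (f (brk M m n x)) r = ?c m n \<otimes>\<^bsub>N\<^esub> brk N (act N (f m) r) (act N (f n) r) x"
      if m [simp]: "m \<in> carrier M" and n [simp]: "n \<in> carrier M" for m n
    proof -
      have [simp]: "brk_defect M N f x m n \<in> B" using cp_bilinear_D(1)[OF quadraticD(5)[OF f]] by simp
      show ?thesis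
        by (simp add: quadratic_brk[OF f] N.A_add_act N.brk_act_1 N.brk_act_2 N.m_assoc)
    qed
    ultimately show "\<exists>c. bilin c \<and> (\<forall>m\<in>carrier M. \<forall>n\<in>carrier M.
        act N (f (brk M m n x)) r = c m n \<otimes>\<^bsub>N\<^esub> brk N (act N (f m) r) (act N (f n) r) x)" by blast
  qed simp_all
qed

lemma quadratic_pointwise_brk:
  assumes f: "quadratic f" and g: "quadratic g" and x [simp]: "x \<in> carrier (Ree R)"
  shows "quadratic (\<lambda>m. brk N (f m) (g m) x)"
proof -
  note [simp] = quadraticD(1,2)[OF f] quadraticD(1,2)[OF g]
  \<comment> \<open>These are the cross terms of \<open>[f m + f n, g m + g n] \<cdot> x\<close>.
    The term \<open>[f n, g m] \<cdot> x\<close> is rewritten with \<open>T\<close> so that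
    \<open>m\<close> occupies the first slot, as \<open>bilin_brk\<close> requires.\<close>
  let ?b = "\<lambda>m n. brk N (f m) (g n) x \<otimes>\<^bsub>N\<^esub> brk N (g m) (f n) (sT R x)"
  have bd: "bilin ?b" by (intro bilin_add bilin_brk f g) simp_all
  show ?thesis
  proof (rule quadraticI[OF _ _ bd])
    fix m n assume m [simp]: "m \<in> carrier M" and n [simp]: "n \<in> carrier M"
    let ?u = "brk N (f m) (g n) x" and ?v = "brk N (f n) (g m) x"
      and ?y = "brk N (f m) (g m) x" and ?z = "brk N (f n) (g n) x"
    have "brk N (f (m \<otimes>\<^bsub>M\<^esub> n)) (g (m \<otimes>\<^bsub>M\<^esub> n)) x = (?y \<otimes>\<^bsub>N\<^esub> ?v) \<otimes>\<^bsub>N\<^esub> (?u \<otimes>\<^bsub>N\<^esub> ?z)"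
      by (simp add: brk_quadratic_add_1[OF f] brk_quadratic_add_2[OF g])
    also have "\<dots> = (?u \<otimes>\<^bsub>N\<^esub> ?v) \<otimes>\<^bsub>N\<^esub> (?y \<otimes>\<^bsub>N\<^esub> ?z)"
      using N.A_central[of ?y ?u] N.A_add_interchange[of ?u ?y ?v ?z]
        N.A_add_interchange[of ?y ?u ?v ?z] by simp
    finally show "brk N (f (m \<otimes>\<^bsub>M\<^esub> n)) (g (m \<otimes>\<^bsub>M\<^esub> n)) x = ?b m n \<otimes>\<^bsub>N\<^esub> (?y \<otimes>\<^bsub>N\<^esub> ?z)"
      by (simp add: N.brk_T)
  next
    fix r assume r [simp]: "r \<in> carrier (Re R)"
    let ?k = "\<lambda>m. brk N (f m) (g m) x"
    let ?q = "\<lambda>m. act N (act N (?k m) r) r \<otimes>\<^bsub>N\<^esub> inv\<^bsub>N\<^esub> act N (?k m) r"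
    have "sqform ?q" by (intro sqform_add sqform_inv sqform_act sqform_brk f g x r)
    moreover have "brk N (f (act M m r)) (g (act M m r)) x = ?q m \<otimes>\<^bsub>N\<^esub> act N (?k m) r"
      if m [simp]: "m \<in> carrier M" for m
      by (simp add: brk_quadratic_act_1[OF f] brk_quadratic_act_2[OF g] N.m_assoc)
    ultimately show "\<exists>q. sqform q \<and> (\<forall>m\<in>carrier M.
        brk N (f (act M m r)) (g (act M m r)) x = q m \<otimes>\<^bsub>N\<^esub> act N (?k m) r)" by blast
  next
    fix y assume y [simp]: "y \<in> carrier (Ree R)"
    \<comment> \<open>Both brackets vanish: \<open>f\<close> and \<open>g\<close> send
      \<open>brk M m n y\<close>, an element of \<open>A\<close>, into \<open>B\<close>, and
      brackets of values of brackets are zero.\<close>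
    show "\<exists>c. bilin c \<and> (\<forall>m\<in>carrier M. \<forall>n\<in>carrier M. brk N (f (brk M m n y)) (g (brk M m n y)) x
        = c m n \<otimes>\<^bsub>N\<^esub> brk N (brk N (f m) (g m) x) (brk N (f n) (g n) x) y)"
      using bilin_zero by (intro exI[of _ "\<lambda>m n. \<one>\<^bsub>N\<^esub>"]) simp
  qed simp_all
qed

lemma quadratic_zero: "quadratic (\<lambda>m. \<one>\<^bsub>N\<^esub>)"
proof (rule quadraticI[OF _ _ bilin_zero])
  show "\<exists>q. sqform q \<and> (\<forall>m\<in>carrier M. \<one>\<^bsub>N\<^esub> = q m \<otimes>\<^bsub>N\<^esub> act N \<one>\<^bsub>N\<^esub> r)"
    if "r \<in> carrier (Re R)" for r
    using that by (intro exI[of _ "\<lambda>m. \<one>\<^bsub>N\<^esub>"]) (simp add: cp_square_form_def)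
  show "\<exists>c. bilin c \<and> (\<forall>m\<in>carrier M. \<forall>n\<in>carrier M. \<one>\<^bsub>N\<^esub> = c m n \<otimes>\<^bsub>N\<^esub> brk N \<one>\<^bsub>N\<^esub> \<one>\<^bsub>N\<^esub> x)"
    if "x \<in> carrier (Ree R)" for x
    using that bilin_zero by (intro exI[of _ "\<lambda>m n. \<one>\<^bsub>N\<^esub>"]) simp
qed simp_all

lemma quadratic_pointwise_inv:
  assumes "quadratic f"
  shows "quadratic (\<lambda>m. inv\<^bsub>N\<^esub> f m)"
  by (rule quadratic_cong[OF quadratic_pointwise_act[OF assms, of "\<ominus>\<^bsub>Re R\<^esub> \<one>\<^bsub>Re R\<^esub>"]])
    (simp_all add: N.act_minus_one quadraticD(1)[OF assms])

lemma sq_linear_imp_quadratic: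
  assumes lin: "sq_linear R M N f" and fA: "\<And>a. a \<in> A \<Longrightarrow> f a \<in> B"
  shows "quadratic f"
proof (rule quadraticI[OF _ fA bilin_zero])
  have f [simp]: "f m \<in> carrier N" if "m \<in> carrier M" for m
    using lin that by (auto simp: sq_linear_def hom_def)
  then show "f m \<in> carrier N" if "m \<in> carrier M" for m using that .
  show "f (m \<otimes>\<^bsub>M\<^esub> n) = \<one>\<^bsub>N\<^esub> \<otimes>\<^bsub>N\<^esub> (f m \<otimes>\<^bsub>N\<^esub> f n)" if "m \<in> carrier M" "n \<in> carrier M" for m n
    using lin that by (simp add: sq_linear_def hom_def)
  show "\<exists>q. sqform q \<and> (\<forall>m\<in>carrier M. f (act M m r) = q m \<otimes>\<^bsub>N\<^esub> act N (f m) r)"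
    if "r \<in> carrier (Re R)" for r
    using that lin by (intro exI[of _ "\<lambda>m. \<one>\<^bsub>N\<^esub>"]) (simp add: cp_square_form_def sq_linear_def)
  show "\<exists>c. bilin c \<and> (\<forall>m\<in>carrier M. \<forall>n\<in>carrier M. f (brk M m n x) = c m n \<otimes>\<^bsub>N\<^esub> brk N (f m) (f n) x)"
    if "x \<in> carrier (Ree R)" for x
    using that lin bilin_zero by (intro exI[of _ "\<lambda>m n. \<one>\<^bsub>N\<^esub>"]) (simp add: sq_linear_def)
qed

section \<open>Composition of CP-quadratic maps\<close>

text \<open>The defects of \<open>g\<close> vanish as soon as one argument lies in \<open>A\<close>,
  so on \<open>A\<close>, and for adding an element of \<open>A\<close>, the map behaves linearly.
  Applied to an outer map, this splits off the error terms of the inner one.\<close>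

lemma
  assumes g: "quadratic g"
  shows quadratic_A_add: "\<lbrakk>a \<in> A; m \<in> carrier M\<rbrakk> \<Longrightarrow> g (a \<otimes>\<^bsub>M\<^esub> m) = g a \<otimes>\<^bsub>N\<^esub> g m"
    and quadratic_A_act: "\<lbrakk>a \<in> A; r \<in> carrier (Re R)\<rbrakk> \<Longrightarrow> g (act M a r) = act N (g a) r"
    and quadratic_A_zero: "g \<one>\<^bsub>M\<^esub> = \<one>\<^bsub>N\<^esub>"
proof -
  note [simp] = quadraticD(1,2)[OF g]
  show add: "g (a \<otimes>\<^bsub>M\<^esub> m) = g a \<otimes>\<^bsub>N\<^esub> g m" if "a \<in> A" "m \<in> carrier M" for a m
    using that cp_bilinear_D(7)[OF quadraticD(3)[OF g]] by (simp add: quadratic_add[OF g])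
  show "g (act M a r) = act N (g a) r" if "a \<in> A" "r \<in> carrier (Re R)" for a r
    using that cp_square_form_D(3)[OF quadraticD(4)[OF g]] by (simp add: quadratic_act[OF g])
  show "g \<one>\<^bsub>M\<^esub> = \<one>\<^bsub>N\<^esub>"
    using add[of "\<one>\<^bsub>M\<^esub>" "\<one>\<^bsub>M\<^esub>"] N.l_cancel_one[of "g \<one>\<^bsub>M\<^esub>" "g \<one>\<^bsub>M\<^esub>"] by simp
qed

text \<open>Each defect of the composite is \<open>g\<close> applied to the defect of
  \<open>f\<close>, plus the defect of \<open>g\<close> at values of \<open>f\<close>. The outer
  part is a form since \<open>g\<close> is linear on \<open>B\<close>; the inner part is one since
  the defects of \<open>g\<close> do not notice a change of argument by an element of
  \<open>B\<close>.\<close>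

lemma quadratic_comp:
  assumes L: "comm_cp_module R L C" and g: "cp_quadratic R (N, B) (L, C) g" and f: "quadratic f"
  shows "cp_quadratic R (M, A) (L, C) (\<lambda>m. g (f m))"
proof -
  interpret L: comm_cp_module R L C by (rule L)
  interpret NL: cp_module_pair R N B L C by unfold_locales
  interpret LM: cp_module_pair R M A L C by unfold_locales
  note [simp] = quadraticD(1,2)[OF f] NL.quadraticD(1,2)[OF g]
  have outer_bilin: "LM.bilin (\<lambda>m n. g (b m n))" if "bilin b" for b
    using that by (simp add: cp_bilinear_def NL.quadratic_A_add[OF g] NL.quadratic_A_act[OF g]
        NL.quadratic_A_zero[OF g])
  have outer_sqform: "LM.sqform (\<lambda>m. g (q m))" if "sqform q" for q
    using that by (simp add: cp_square_form_def NL.quadratic_A_act[OF g] NL.quadratic_A_zero[OF g])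
  have inner_bilin: "LM.bilin (\<lambda>m n. b (f m) (f n))" if b: "NL.bilin b" for b
    using cp_bilinear_D[OF b] cp_bilinear_D(1)[OF quadraticD(3)[OF f]]
      cp_square_form_D(1)[OF quadraticD(4)[OF f]]
    by (simp add: cp_bilinear_def quadratic_add[OF f] quadratic_act[OF f])
  have inner_sqform: "LM.sqform (\<lambda>m. act_defect N L g r (f m))" if r: "r \<in> carrier (Re R)" for r
  proof -
    note q = NL.quadraticD(4)[OF g r]
    \<comment> \<open>The scalar defect of \<open>g\<close> is not known to be additive, so its
      invariance under translation by \<open>B\<close> is computed directly: the contribution of
      \<open>b\<close> occurs once with each sign and is central.\<close>
    have shift: "act_defect N L g r (b \<otimes>\<^bsub>N\<^esub> n) = act_defect N L g r n"
      if b: "b \<in> B" and n: "n \<in> carrier N" for b n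
    proof -
      let ?u = "act L (g b) r" and ?y = "g (act N n r)" and ?z = "act L (g n) r"
      have u: "?u \<in> C" using b r by simp
      have "act_defect N L g r (b \<otimes>\<^bsub>N\<^esub> n) = (?u \<otimes>\<^bsub>L\<^esub> ?y) \<otimes>\<^bsub>L\<^esub> (inv\<^bsub>L\<^esub> ?u \<otimes>\<^bsub>L\<^esub> inv\<^bsub>L\<^esub> ?z)"
        using b n r L.A_central[OF L.A_inv[OF u], of "inv\<^bsub>L\<^esub> ?z"]
        by (simp add: act_defect_def N.A_add_act L.A_add_act NL.quadratic_A_add[OF g]
            NL.quadratic_A_act[OF g] L.inv_mult_group)
      also have "\<dots> = (?u \<otimes>\<^bsub>L\<^esub> inv\<^bsub>L\<^esub> ?u) \<otimes>\<^bsub>L\<^esub> (?y \<otimes>\<^bsub>L\<^esub> inv\<^bsub>L\<^esub> ?z)"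
        using b n r u by (intro L.A_add_interchange) simp_all
      finally show ?thesis using b n r by (simp add: act_defect_def)
    qed
    show ?thesis
      using cp_square_form_D[OF q] cp_square_form_D(1)[OF quadraticD(4)[OF f]] r
      by (simp add: cp_square_form_def quadratic_act[OF f] shift)
  qed
  have bd: "LM.bilin (\<lambda>m n. g (deviation M N f m n) \<otimes>\<^bsub>L\<^esub> deviation N L g (f m) (f n))"
    by (intro LM.bilin_add outer_bilin inner_bilin quadraticD(3) NL.quadraticD(3) f g)
  show ?thesis
  proof (rule LM.quadraticI[OF _ _ bd])
    fix m n assume m [simp]: "m \<in> carrier M" and n [simp]: "n \<in> carrier M"
    have [simp]: "deviation M N f m n \<in> B" "deviation N L g (f m) (f n) \<in> C"
      using cp_bilinear_D(1)[OF quadraticD(3)[OF f]] cp_bilinear_D(1)[OF NL.quadraticD(3)[OF g]]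
      by simp_all
    show "g (f (m \<otimes>\<^bsub>M\<^esub> n)) = g (deviation M N f m n) \<otimes>\<^bsub>L\<^esub> deviation N L g (f m) (f n)
        \<otimes>\<^bsub>L\<^esub> (g (f m) \<otimes>\<^bsub>L\<^esub> g (f n))"
      by (simp add: quadratic_add[OF f] NL.quadratic_A_add[OF g] NL.quadratic_add[OF g] L.m_assoc)
  next
    fix r assume r [simp]: "r \<in> carrier (Re R)"
    let ?q = "\<lambda>m. g (act_defect M N f r m) \<otimes>\<^bsub>L\<^esub> act_defect N L g r (f m)"
    have "LM.sqform ?q"
      by (intro LM.sqform_add outer_sqform inner_sqform quadraticD(4) f r)
    moreover have "g (f (act M m r)) = ?q m \<otimes>\<^bsub>L\<^esub> act L (g (f m)) r" if m [simp]: "m \<in> carrier M" for m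
    proof -
      have [simp]: "act_defect M N f r m \<in> B" "act_defect N L g r (f m) \<in> C"
        using cp_square_form_D(1)[OF quadraticD(4)[OF f]]
          cp_square_form_D(1)[OF NL.quadraticD(4)[OF g]] by simp_all
      show ?thesis
        by (simp add: quadratic_act[OF f] NL.quadratic_A_add[OF g] NL.quadratic_act[OF g] L.m_assoc)
    qed
    ultimately show "\<exists>q. LM.sqform q \<and>
        (\<forall>m\<in>carrier M. g (f (act M m r)) = q m \<otimes>\<^bsub>L\<^esub> act L (g (f m)) r)" by blast
  next
    fix x assume x [simp]: "x \<in> carrier (Ree R)"
    let ?c = "\<lambda>m n. g (brk_defect M N f x m n) \<otimes>\<^bsub>L\<^esub> brk_defect N L g x (f m) (f n)"
    have "LM.bilin ?c"
      by (intro LM.bilin_add outer_bilin inner_bilin quadraticD(5) NL.quadraticD(5) f g x)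
    moreover have "g (f (brk M m n x)) = ?c m n \<otimes>\<^bsub>L\<^esub> brk L (g (f m)) (g (f n)) x"
      if m [simp]: "m \<in> carrier M" and n [simp]: "n \<in> carrier M" for m n
    proof -
      have [simp]: "brk_defect M N f x m n \<in> B" "brk_defect N L g x (f m) (f n) \<in> C"
        using cp_bilinear_D(1)[OF quadraticD(5)[OF f]] cp_bilinear_D(1)[OF NL.quadraticD(5)[OF g]]
        by simp_all
      show ?thesis
        by (simp add: quadratic_brk[OF f] NL.quadratic_A_add[OF g] NL.quadratic_brk[OF g] L.m_assoc)
    qed
    ultimately show "\<exists>c. LM.bilin c \<and> (\<forall>m\<in>carrier M. \<forall>n\<in>carrier M.
        g (f (brk M m n x)) = c m n \<otimes>\<^bsub>L\<^esub> brk L (g (f m)) (g (f n)) x)" by blast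
  qed simp_all
qed

section \<open>The internal Hom\<close>

abbreviation Hom :: "('m \<Rightarrow> 'n, 'e, 'x) bhp"
  where "Hom \<equiv> cp_hom_bhp R (M, A) (N, B)"

definition HomA :: "('m \<Rightarrow> 'n) set"
  where "HomA = {f \<in> cp_maps R (M, A) (N, B). f ` carrier M \<subseteq> B \<and> f ` A \<subseteq> {\<one>\<^bsub>N\<^esub>}}"

lemma cp_maps_iff: "f \<in> cp_maps R (M, A) (N, B) \<longleftrightarrow> f \<in> extensional (carrier M) \<and> quadratic f"
  by (auto simp: cp_maps.simps PiE_def dest: quadraticD(1))

lemma cp_maps_quadratic: "f \<in> cp_maps R (M, A) (N, B) \<Longrightarrow> quadratic f"
  by (simp add: cp_maps_iff)

lemma cp_maps_eqI:
  assumes "f \<in> cp_maps R (M, A) (N, B)" "g \<in> cp_maps R (M, A) (N, B)"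
    and "\<And>m. m \<in> carrier M \<Longrightarrow> f m = g m"
  shows "f = g"
  using assms extensionalityI[of f "carrier M" g] by (simp add: cp_maps_iff)

lemma cp_maps_closed [simp]:
  "\<lbrakk>f \<in> cp_maps R (M, A) (N, B); m \<in> carrier M\<rbrakk> \<Longrightarrow> f m \<in> carrier N"
  "\<lbrakk>f \<in> cp_maps R (M, A) (N, B); a \<in> A\<rbrakk> \<Longrightarrow> f a \<in> B"
  using quadraticD(1,2) by (auto simp: cp_maps_iff)

lemma restrict_cp_maps: "quadratic f \<Longrightarrow> restrict f (carrier M) \<in> cp_maps R (M, A) (N, B)"
  unfolding cp_maps_iff by (auto intro: quadratic_cong)

lemma Hom_sel:
  "carrier Hom = cp_maps R (M, A) (N, B)"
  "f \<otimes>\<^bsub>Hom\<^esub> g = (\<lambda>m\<in>carrier M. f m \<otimes>\<^bsub>N\<^esub> g m)"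
  "\<one>\<^bsub>Hom\<^esub> = (\<lambda>m\<in>carrier M. \<one>\<^bsub>N\<^esub>)"
  "act Hom f r = (\<lambda>m\<in>carrier M. act N (f m) r)"
  "brk Hom f g x = (\<lambda>m\<in>carrier M. brk N (f m) (g m) x)"
  by (simp_all add: cp_hom_bhp.simps)

lemma HomA_iff:
  "f \<in> HomA \<longleftrightarrow> f \<in> cp_maps R (M, A) (N, B) \<and> (\<forall>m\<in>carrier M. f m \<in> B) \<and> (\<forall>a\<in>A. f a = \<one>\<^bsub>N\<^esub>)"
  by (auto simp: HomA_def)

text \<open>The last clause speaks of the pointwise inverse because it supplies the inverses in the
  proof that \<open>Hom\<close> is a group; \<open>Hom_inv\<close> then identifies it with the group
  inverse.\<close>

lemma Hom_closed:
  "\<lbrakk>f \<in> carrier Hom; g \<in> carrier Hom\<rbrakk> \<Longrightarrow> f \<otimes>\<^bsub>Hom\<^esub> g \<in> carrier Hom"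
  "\<one>\<^bsub>Hom\<^esub> \<in> carrier Hom"
  "\<lbrakk>f \<in> carrier Hom; r \<in> carrier (Re R)\<rbrakk> \<Longrightarrow> act Hom f r \<in> carrier Hom"
  "\<lbrakk>f \<in> carrier Hom; g \<in> carrier Hom; x \<in> carrier (Ree R)\<rbrakk> \<Longrightarrow> brk Hom f g x \<in> carrier Hom"
  "f \<in> carrier Hom \<Longrightarrow> (\<lambda>m\<in>carrier M. inv\<^bsub>N\<^esub> f m) \<in> carrier Hom"
  unfolding Hom_sel
  by (auto intro!: restrict_cp_maps quadratic_pointwise_add quadratic_pointwise_act quadratic_zero
      quadratic_pointwise_brk quadratic_pointwise_inv dest: cp_maps_quadratic)

lemma Hom_group: "group Hom"
proof (rule groupI)
  fix f assume f: "f \<in> carrier Hom"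
  show "\<one>\<^bsub>Hom\<^esub> \<otimes>\<^bsub>Hom\<^esub> f = f"
    by (rule cp_maps_eqI) (use f Hom_closed(1)[OF Hom_closed(2) f] in \<open>simp_all add: Hom_sel\<close>)
  show "\<exists>g\<in>carrier Hom. g \<otimes>\<^bsub>Hom\<^esub> f = \<one>\<^bsub>Hom\<^esub>"
    using f by (intro bexI[OF _ Hom_closed(5)[OF f]] ext) (simp add: Hom_sel restrict_def)
next
  fix f g h assume "f \<in> carrier Hom" "g \<in> carrier Hom" "h \<in> carrier Hom"
  then show "f \<otimes>\<^bsub>Hom\<^esub> g \<otimes>\<^bsub>Hom\<^esub> h = f \<otimes>\<^bsub>Hom\<^esub> (g \<otimes>\<^bsub>Hom\<^esub> h)"
    by (intro ext) (simp add: Hom_sel restrict_def N.m_assoc)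
qed (simp_all add: Hom_closed)

lemma Hom_inv: "f \<in> carrier Hom \<Longrightarrow> inv\<^bsub>Hom\<^esub> f = (\<lambda>m\<in>carrier M. inv\<^bsub>N\<^esub> f m)"
  by (rule group.inv_equality[OF Hom_group _ _ Hom_closed(5)])
    (auto simp: Hom_sel restrict_def fun_eq_iff)

text \<open>The axioms hold pointwise. A bracket of two maps lies in \<open>HomA\<close>: its values
  lie in \<open>B\<close>, and on \<open>A\<close> both maps already take values in
  \<open>B\<close>, so the bracket is zero there.\<close>

lemma Hom_comm_cp_module: "comm_cp_module R Hom HomA"
proof -
  have "bhp_module R Hom"
  proof (intro bhp_module.intro Hom_group Hom_closed)
    fix f assume f: "f \<in> carrier Hom"
    \<comment> \<open>The left side is a restriction of \<open>f\<close>; it equals \<open>f\<close>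
      because morphisms are extensional.\<close>
    show "act Hom f \<one>\<^bsub>Re R\<^esub> = f"
      by (rule cp_maps_eqI)
        (use f Hom_closed(3)[OF f M.Re_one_closed] in \<open>simp_all add: Hom_sel N.act_one\<close>)
  qed (auto simp: Hom_sel restrict_def fun_eq_iff N.act_mult N.act_add N.add_act N.act_P N.brk_T
      N.brk_add_1 N.brk_add_2 N.brk_add_3 N.brk_act N.brk_brk)
  moreover have "subgroup HomA Hom"
  proof (rule group.subgroupI[OF Hom_group])
    show "HomA \<subseteq> carrier Hom" by (auto simp: HomA_iff Hom_sel)
    have "\<one>\<^bsub>Hom\<^esub> \<in> HomA" using Hom_closed(2) by (simp add: HomA_iff Hom_sel)
    then show "HomA \<noteq> {}" by blast
  next
    fix f assume "f \<in> HomA"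
    then show "inv\<^bsub>Hom\<^esub> f \<in> HomA"
      using Hom_closed(5)[of f] Hom_inv[of f] by (simp add: HomA_iff Hom_sel)
  next
    fix f g assume "f \<in> HomA" "g \<in> HomA"
    then show "f \<otimes>\<^bsub>Hom\<^esub> g \<in> HomA"
      using Hom_closed(1)[of f g] by (simp add: HomA_iff Hom_sel)
  qed
  moreover have "act Hom f r \<in> HomA" if "f \<in> HomA" "r \<in> carrier (Re R)" for f r
    using that Hom_closed(3)[of f r] by (simp add: HomA_iff Hom_sel)
  moreover have "brk Hom f g x = \<one>\<^bsub>Hom\<^esub>"
    if "f \<in> HomA" "g \<in> carrier Hom" "x \<in> carrier (Ree R)" for f g x
    using that by (auto simp: HomA_iff Hom_sel restrict_def fun_eq_iff)
  moreover have "brk Hom f g x \<in> HomA"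
    if "f \<in> carrier Hom" "g \<in> carrier Hom" "x \<in> carrier (Ree R)" for f g x
    using that Hom_closed(4)[of f g x] by (simp add: HomA_iff Hom_sel)
  ultimately show ?thesis
    by (intro comm_cp_module.intro cp_module.intro cp_module_axioms.intro
        M.comm_square_ring_axioms)
qed

lemma cp_hom_eq: "cp_hom R (M, A) (N, B) = (Hom, HomA)"
  by (simp add: cp_hom.simps HomA_def)

section \<open>Action of pairs of CP-quadratic maps on internal Homs\<close>

text \<open>Two variables have to be kept apart. Bilinearity or homogeneity in the maps
  \<open>h\<close>, \<open>h'\<close> is read off from \<open>g\<close> at each \<open>k\<close>; in
  addition every defect, as a function of \<open>k\<close>, must be CP-quadratic in order to be an
  element of the target Hom.\<close>

lemma Hom_map_quadratic:
  assumes K: "comm_cp_module R K D" and L: "comm_cp_module R L C"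
    and f: "cp_quadratic R (K, D) (M, A) f" and g: "cp_quadratic R (N, B) (L, C) g"
  shows "cp_quadratic R (cp_hom R (M, A) (N, B)) (cp_hom R (K, D) (L, C))
    (\<lambda>h. \<lambda>k\<in>carrier K. g (h (f k)))"
proof -
  interpret K: comm_cp_module R K D by (rule K)
  interpret L: comm_cp_module R L C by (rule L)
  interpret KM: cp_module_pair R K D M A by unfold_locales
  interpret KN: cp_module_pair R K D N B by unfold_locales
  interpret KL: cp_module_pair R K D L C by unfold_locales
  interpret NL: cp_module_pair R N B L C by unfold_locales
  interpret H: cp_module_pair R Hom HomA KL.Hom KL.HomA
    by (intro cp_module_pair.intro Hom_comm_cp_module KL.Hom_comm_cp_module)
  note [simp] = KM.quadraticD(1,2)[OF f] NL.quadraticD(1,2)[OF g]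
  have comp_f: "KN.quadratic (\<lambda>k. h (f k))" if "h \<in> carrier Hom" for h
    using that by (intro KM.quadratic_comp[OF N.comm_cp_module_axioms _ f] cp_maps_quadratic)
      (simp add: Hom_sel)
  have comp_g: "KL.quadratic (\<lambda>k. g (u k))" if "KN.quadratic u" for u
    using that by (rule KN.quadratic_comp[OF L g])
  have comp_HomA: "(\<lambda>k\<in>carrier K. g (h (f k))) \<in> KL.HomA" if "h \<in> HomA" for h
    using that by (auto simp: KL.HomA_iff HomA_iff Hom_sel NL.quadratic_A_zero[OF g]
        intro!: KL.restrict_cp_maps comp_g comp_f)
  \<comment> \<open>The values lie in \<open>KL.HomA\<close> since \<open>c\<close> takes values in
    \<open>C\<close> and, for \<open>k\<close> in \<open>D\<close>, its arguments lie in
    \<open>B\<close>, where it vanishes. The premise \<open>q\<close> supplies quadraticity in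
    \<open>k\<close>.\<close>
  have bilin_Hom: "H.bilin (\<lambda>h h'. \<lambda>k\<in>carrier K. c (h (f k)) (h' (f k)))"
    if c: "NL.bilin c" and q: "\<And>h h'. \<lbrakk>h \<in> carrier Hom; h' \<in> carrier Hom\<rbrakk>
      \<Longrightarrow> KL.quadratic (\<lambda>k. c (h (f k)) (h' (f k)))" for c
    using cp_bilinear_D[OF c] KL.restrict_cp_maps[OF q]
    by (auto simp: cp_bilinear_def Hom_sel KL.Hom_sel HomA_iff KL.HomA_iff restrict_def fun_eq_iff)
  have sqform_Hom: "H.sqform (\<lambda>h. \<lambda>k\<in>carrier K. q (h (f k)))"
    if c: "NL.sqform q" and q: "\<And>h. h \<in> carrier Hom \<Longrightarrow> KL.quadratic (\<lambda>k. q (h (f k)))" for q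
    using cp_square_form_D[OF c] KL.restrict_cp_maps[OF q]
    by (auto simp: cp_square_form_def Hom_sel KL.Hom_sel HomA_iff KL.HomA_iff restrict_def fun_eq_iff)
  \<comment> \<open>Unfolding the deviation displays it as sums and inverses of composites, so its
    quadraticity in \<open>k\<close> follows from the closure lemmas.\<close>
  have dev: "H.bilin (\<lambda>h h'. \<lambda>k\<in>carrier K. deviation N L g (h (f k)) (h' (f k)))"
    by (rule bilin_Hom[OF NL.quadraticD(3)[OF g]], unfold deviation_def)
      (intro KL.quadratic_pointwise_add KL.quadratic_pointwise_inv comp_g
        KN.quadratic_pointwise_add comp_f)
  show ?thesis
    unfolding cp_hom_eq KL.cp_hom_eq
  proof (rule H.quadraticI[where b = "\<lambda>h h'. \<lambda>k\<in>carrier K. deviation N L g (h (f k)) (h' (f k))"])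
    show "(\<lambda>k\<in>carrier K. g (h (f k))) \<in> carrier KL.Hom" if "h \<in> carrier Hom" for h
      unfolding KL.Hom_sel by (intro KL.restrict_cp_maps comp_g comp_f that)
    show "(\<lambda>k\<in>carrier K. g (h (f k))) \<in> KL.HomA" if "h \<in> HomA" for h
      using that by (rule comp_HomA)
    show "H.bilin (\<lambda>h h'. \<lambda>k\<in>carrier K. deviation N L g (h (f k)) (h' (f k)))"
      by (rule dev)
    show "(\<lambda>k\<in>carrier K. g ((h \<otimes>\<^bsub>Hom\<^esub> h') (f k)))
        = (\<lambda>k\<in>carrier K. deviation N L g (h (f k)) (h' (f k))) \<otimes>\<^bsub>KL.Hom\<^esub>
          ((\<lambda>k\<in>carrier K. g (h (f k))) \<otimes>\<^bsub>KL.Hom\<^esub> (\<lambda>k\<in>carrier K. g (h' (f k))))"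
      if "h \<in> carrier Hom" "h' \<in> carrier Hom" for h h'
      using that by (intro ext) (simp add: Hom_sel KL.Hom_sel NL.quadratic_add[OF g])
  next
    fix r assume r: "r \<in> carrier (Re R)"
    have "H.sqform (\<lambda>h. \<lambda>k\<in>carrier K. act_defect N L g r (h (f k)))"
      by (rule sqform_Hom[OF NL.quadraticD(4)[OF g r]], unfold act_defect_def)
        (intro KL.quadratic_pointwise_add KL.quadratic_pointwise_inv KL.quadratic_pointwise_act
          comp_g KN.quadratic_pointwise_act comp_f r)
    moreover have "(\<lambda>k\<in>carrier K. g (act Hom h r (f k)))
        = (\<lambda>k\<in>carrier K. act_defect N L g r (h (f k))) \<otimes>\<^bsub>KL.Hom\<^esub>
          act KL.Hom (\<lambda>k\<in>carrier K. g (h (f k))) r" if "h \<in> carrier Hom" for h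
      using that r by (intro ext) (simp add: Hom_sel KL.Hom_sel NL.quadratic_act[OF g])
    ultimately show "\<exists>q. H.sqform q \<and> (\<forall>h\<in>carrier Hom. (\<lambda>k\<in>carrier K. g (act Hom h r (f k)))
        = q h \<otimes>\<^bsub>KL.Hom\<^esub> act KL.Hom (\<lambda>k\<in>carrier K. g (h (f k))) r)"
      by (intro exI[of _ "\<lambda>h. \<lambda>k\<in>carrier K. act_defect N L g r (h (f k))"]) simp
  next
    fix x assume x: "x \<in> carrier (Ree R)"
    have "H.bilin (\<lambda>h h'. \<lambda>k\<in>carrier K. brk_defect N L g x (h (f k)) (h' (f k)))"
      by (rule bilin_Hom[OF NL.quadraticD(5)[OF g x]], unfold brk_defect_def)
        (intro KL.quadratic_pointwise_add KL.quadratic_pointwise_inv KL.quadratic_pointwise_brk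
          comp_g KN.quadratic_pointwise_brk comp_f x)
    moreover have "(\<lambda>k\<in>carrier K. g (brk Hom h h' x (f k)))
        = (\<lambda>k\<in>carrier K. brk_defect N L g x (h (f k)) (h' (f k))) \<otimes>\<^bsub>KL.Hom\<^esub>
          brk KL.Hom (\<lambda>k\<in>carrier K. g (h (f k))) (\<lambda>k\<in>carrier K. g (h' (f k))) x"
      if "h \<in> carrier Hom" "h' \<in> carrier Hom" for h h'
      using that x by (intro ext) (simp add: Hom_sel KL.Hom_sel NL.quadratic_brk[OF g])
    ultimately show "\<exists>c. H.bilin c \<and> (\<forall>h\<in>carrier Hom. \<forall>h'\<in>carrier Hom.
        (\<lambda>k\<in>carrier K. g (brk Hom h h' x (f k)))
        = c h h' \<otimes>\<^bsub>KL.Hom\<^esub>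
          brk KL.Hom (\<lambda>k\<in>carrier K. g (h (f k))) (\<lambda>k\<in>carrier K. g (h' (f k))) x)"
      by (intro exI[of _ "\<lambda>h h'. \<lambda>k\<in>carrier K. brk_defect N L g x (h (f k)) (h' (f k))"]) simp
  qed
qed

end

section \<open>The category of CP-modules\<close>

text \<open>The Hom group of the prequadratic structure and the internal Hom share their group
  operations but have different record types; this carries the group axioms from one to the
  other.\<close>

lemma group_cong:
  fixes G :: "('g, 'k) monoid_scheme" and H :: "('g, 'l) monoid_scheme"
  assumes "group G"
    and eq: "carrier H = carrier G" "monoid.mult H = monoid.mult G" "one H = one G"
  shows "group H"
proof -
  interpret group G by fact
  show ?thesis by (rule groupI) (auto simp: eq m_assoc intro: bexI[of _ "inv\<^bsub>G\<^esub> _"])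
qed

context comm_square_ring
begin

lemma cp_module_pairI:
  "\<lbrakk>cp_module R M A; cp_module R N B\<rbrakk> \<Longrightarrow> cp_module_pair R M A N B"
  by (intro cp_module_pair.intro comm_cp_module.intro comm_square_ring_axioms)

lemma CP_category_sel:
  "(M, A) \<in> ob (CP_category R) \<longleftrightarrow> cp_module R M A"
  "mor (CP_category R) = cp_maps R"
  "idn (CP_category R) (M, A) = (\<lambda>m\<in>carrier M. m)"
  "cmp (CP_category R) (M, A) Y Z g f = compose (carrier M) g f"
  by (simp_all add: CP_category_def)

lemma idn_cp_maps:
  assumes "cp_module R M A"
  shows "(\<lambda>m\<in>carrier M. m) \<in> cp_maps R (M, A) (M, A)"
proof -
  interpret cp_module_pair R M A M A by (intro cp_module_pairI assms)
  show ?thesis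
    by (intro restrict_cp_maps sq_linear_imp_quadratic) (auto simp: sq_linear_def hom_def)
qed

lemma compose_cp_maps:
  assumes "cp_module R M A" "cp_module R N B" "cp_module R L C"
    and f: "f \<in> cp_maps R (M, A) (N, B)" and g: "g \<in> cp_maps R (N, B) (L, C)"
  shows "compose (carrier M) g f \<in> cp_maps R (M, A) (L, C)"
proof -
  interpret MN: cp_module_pair R M A N B by (intro cp_module_pairI assms)
  interpret NL: cp_module_pair R N B L C by (intro cp_module_pairI assms)
  interpret LM: cp_module_pair R M A L C by (intro cp_module_pairI assms)
  show ?thesis
    unfolding compose_def
    by (intro LM.restrict_cp_maps MN.quadratic_comp[OF NL.N.comm_cp_module_axioms]
        NL.cp_maps_quadratic[OF g] MN.cp_maps_quadratic[OF f])
qed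

lemma cp_maps_extensional: "f \<in> cp_maps R (M, A) Y \<Longrightarrow> f \<in> extensional (carrier M)"
  by (cases Y) (auto simp: cp_maps.simps PiE_def)

lemma cp_maps_in: "f \<in> cp_maps R (M, A) (N, B) \<Longrightarrow> f \<in> carrier M \<rightarrow> carrier N"
  by (auto simp: cp_maps.simps)

lemma CP_category: "category (CP_category R)"
proof
  fix W X Y Z :: "('m, 'e, 'x) cp_pair" and f g h
  obtain M A where X: "X = (M, A)" by (cases X)
  obtain N B where Y: "Y = (N, B)" by (cases Y)
  obtain L C where Z: "Z = (L, C)" by (cases Z)
  obtain K D where W: "W = (K, D)" by (cases W)
  show "idn (CP_category R) X \<in> mor (CP_category R) X X" if "X \<in> ob (CP_category R)"
    using that by (simp add: X CP_category_sel idn_cp_maps)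
  show "cmp (CP_category R) X Y Z g f \<in> mor (CP_category R) X Z"
    if "X \<in> ob (CP_category R)" "Y \<in> ob (CP_category R)" "Z \<in> ob (CP_category R)"
      "f \<in> mor (CP_category R) X Y" "g \<in> mor (CP_category R) Y Z"
    using that by (simp add: X Y Z CP_category_sel compose_cp_maps)
  show "cmp (CP_category R) X Y Y (idn (CP_category R) Y) f = f"
    if "f \<in> mor (CP_category R) X Y"
    using that by (auto simp: X Y CP_category_sel intro!: Id_compose cp_maps_in
        elim: cp_maps_extensional)
  show "cmp (CP_category R) X X Y f (idn (CP_category R) X) = f"
    if "f \<in> mor (CP_category R) X Y"
    using that by (auto simp: X Y CP_category_sel intro!: compose_Id cp_maps_in
        elim: cp_maps_extensional)
  show "cmp (CP_category R) W X Z (cmp (CP_category R) X Y Z h g) f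
      = cmp (CP_category R) W Y Z h (cmp (CP_category R) W X Y g f)"
    if "f \<in> mor (CP_category R) W X"
    using that cp_maps_in[of f K D M A]
    by (auto simp: W X CP_category_sel compose_def fun_eq_iff)
qed

lemma internal_Hom_mor_in:
  assumes mods: "cp_module R M A" "cp_module R N B" "cp_module R K D" "cp_module R L C"
    and f: "f \<in> cp_maps R (K, D) (M, A)" and g: "g \<in> cp_maps R (N, B) (L, C)"
  shows "internal_Hom_mor R ((M, A), (N, B)) ((K, D), (L, C)) (f, g)
    \<in> cp_maps R (cp_hom R (M, A) (N, B)) (cp_hom R (K, D) (L, C))"
proof -
  interpret MN: cp_module_pair R M A N B by (intro cp_module_pairI mods)
  interpret KL: cp_module_pair R K D L C by (intro cp_module_pairI mods)
  interpret KM: cp_module_pair R K D M A by (intro cp_module_pairI mods)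
  interpret NL: cp_module_pair R N B L C by (intro cp_module_pairI mods)
  interpret H: cp_module_pair R MN.Hom MN.HomA KL.Hom KL.HomA
    by (intro cp_module_pair.intro MN.Hom_comm_cp_module KL.Hom_comm_cp_module)
  have "H.quadratic (\<lambda>h. \<lambda>k\<in>carrier K. g (h (f k)))"
    using MN.Hom_map_quadratic[OF KL.M.comm_cp_module_axioms KL.N.comm_cp_module_axioms
        KM.cp_maps_quadratic[OF f] NL.cp_maps_quadratic[OF g]]
    by (simp add: MN.cp_hom_eq KL.cp_hom_eq)
  from H.restrict_cp_maps[OF this]
  have "(\<lambda>h\<in>carrier MN.Hom. \<lambda>k\<in>carrier K. g (h (f k))) \<in> cp_maps R (MN.Hom, MN.HomA) (KL.Hom, KL.HomA)" .
  also have "(\<lambda>h\<in>carrier MN.Hom. \<lambda>k\<in>carrier K. g (h (f k)))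
      = internal_Hom_mor R ((M, A), (N, B)) ((K, D), (L, C)) (f, g)"
    by (simp add: internal_Hom_mor_def MN.Hom_sel compose_def restrict_def fun_eq_iff)
  finally show ?thesis by (simp add: MN.cp_hom_eq KL.cp_hom_eq)
qed

lemma CP_category_prequadratic: "prequadratic_right (CP_category R) (cp_hom_group R)"
proof (intro prequadratic_right.intro prequadratic_right_axioms.intro CP_category)
  fix X Y Z :: "('m, 'e, 'x) cp_pair" and f g
  obtain M A where X: "X = (M, A)" by (cases X)
  obtain N B where Y: "Y = (N, B)" by (cases Y)
  obtain L C where Z: "Z = (L, C)" by (cases Z)
  have same: "carrier (cp_hom_group R S T) = carrier (cp_hom_bhp R S T)"
    "monoid.mult (cp_hom_group R S T) = monoid.mult (cp_hom_bhp R S T)"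
    "one (cp_hom_group R S T) = one (cp_hom_bhp R S T)"
    for S T :: "('m, 'e, 'x) cp_pair"
    by (cases S; cases T; simp add: cp_hom_group.simps cp_hom_bhp.simps)+
  show "carrier (cp_hom_group R X Y) = mor (CP_category R) X Y"
    by (simp add: X Y CP_category_sel cp_hom_group.simps)
  show "group (cp_hom_group R X Y)" if "X \<in> ob (CP_category R)" "Y \<in> ob (CP_category R)"
  proof -
    interpret MN: cp_module_pair R M A N B
      using that by (intro cp_module_pairI) (simp_all add: X Y CP_category_sel)
    show ?thesis
      by (rule group_cong[OF MN.Hom_group]) (simp_all add: X Y same)
  qed
  \<comment> \<open>Sums of maps are formed in the target, so evaluating them at \<open>f m\<close>
    produces no error term.\<close>
  show "(\<lambda>g. cmp (CP_category R) X Y Z g f) \<in> hom (cp_hom_group R Y Z) (cp_hom_group R X Z)"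
    if "X \<in> ob (CP_category R)" "Y \<in> ob (CP_category R)" "Z \<in> ob (CP_category R)"
      "f \<in> mor (CP_category R) X Y"
    using that cp_maps_in[of f M A N B]
    by (auto simp: hom_def X Y Z CP_category_sel cp_hom_group.simps compose_cp_maps)
      (auto simp: compose_def fun_eq_iff)
  show "quadratic_map (cp_hom_group R X Y) (cp_hom_group R X Z) (\<lambda>f. cmp (CP_category R) X Y Z g f)"
    if ob: "X \<in> ob (CP_category R)" "Y \<in> ob (CP_category R)" "Z \<in> ob (CP_category R)"
      and g: "g \<in> mor (CP_category R) Y Z"
  proof -
    have mods: "cp_module R M A" "cp_module R N B" "cp_module R L C"
      using ob by (simp_all add: X Y Z CP_category_sel)
    interpret MN: cp_module_pair R M A N B by (intro cp_module_pairI mods)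
    interpret LM: cp_module_pair R M A L C by (intro cp_module_pairI mods)
    interpret H: cp_module_pair R MN.Hom MN.HomA LM.Hom LM.HomA
      by (intro cp_module_pair.intro MN.Hom_comm_cp_module LM.Hom_comm_cp_module)
    \<comment> \<open>Postcomposition with \<open>g\<close> is the action of the pair consisting of
      the identity and \<open>g\<close>.\<close>
    have "internal_Hom_mor R (X, Y) (X, Z) (\<lambda>m\<in>carrier M. m, g)
        \<in> cp_maps R (MN.Hom, MN.HomA) (LM.Hom, LM.HomA)"
      using internal_Hom_mor_in[OF mods(1,2,1,3) idn_cp_maps[OF mods(1)]] g
      by (simp add: X Y Z CP_category_sel MN.cp_hom_eq LM.cp_hom_eq)
    then have "H.quadratic (\<lambda>f. cmp (CP_category R) X Y Z g f)"
      by (rule H.quadratic_cong[OF H.cp_maps_quadratic])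
        (simp add: X Y Z internal_Hom_mor_def MN.Hom_sel CP_category_sel compose_def
          restrict_def fun_eq_iff)
    \<comment> \<open>For this map between internal Homs, bilinearity of the deviation contains the
      biadditivity that a quadratic map of groups requires.\<close>
    then have "quadratic_map MN.Hom LM.Hom (\<lambda>f. cmp (CP_category R) X Y Z g f)"
      by (simp add: cp_quadratic.simps quadratic_map_def sq_bilinear_def sq_linear_def)
    then show ?thesis
      by (simp add: X Y Z quadratic_map_def hom_def deviation_def m_inv_def same)
  qed
qed

end

section \<open>Opposite and product categories, and the Hom functor\<close>

lemma category_op: "category C \<Longrightarrow> category (op_category C)"
  by (auto simp: category_def op_category_def)

lemma category_prod: "\<lbrakk>category C; category D\<rbrakk> \<Longrightarrow> category (prod_category C D)"
  by (auto simp: category_def prod_category_def)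

text \<open>A type serves as the universe of underlying sets, so maps from modules over
  \<open>'a\<close> to modules over \<open>'b\<close> form modules over
  \<open>'a \<Rightarrow> 'b\<close>. The two arguments of the functor may use independent
  universes.\<close>

theorem mainTheorem1:
  fixes R :: "('e, 'x) square_ring"
  assumes "comm_square_ring R"
  shows "category (CP_category R :: (('a, 'e, 'x) cp_pair, 'a \<Rightarrow> 'a) category)
    \<and> prequadratic_right (CP_category R :: (('a, 'e, 'x) cp_pair, 'a \<Rightarrow> 'a) category)
        (cp_hom_group R)
    \<and> cat_functor
        (prod_category
          (op_category (CP_category R :: (('a, 'e, 'x) cp_pair, 'a \<Rightarrow> 'a) category))
          (CP_category R :: (('b, 'e, 'x) cp_pair, 'b \<Rightarrow> 'b) category))
        (CP_category R :: (('a \<Rightarrow> 'b, 'e, 'x) cp_pair, ('a \<Rightarrow> 'b) \<Rightarrow> ('a \<Rightarrow> 'b)) category)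
        (internal_Hom_ob R) (internal_Hom_mor R)"
proof (intro conjI)
  interpret comm_square_ring R by (rule assms)
  let ?P = "prod_category
          (op_category (CP_category R :: (('a, 'e, 'x) cp_pair, 'a \<Rightarrow> 'a) category))
          (CP_category R :: (('b, 'e, 'x) cp_pair, 'b \<Rightarrow> 'b) category)"
  let ?D = "CP_category R :: (('a \<Rightarrow> 'b, 'e, 'x) cp_pair, ('a \<Rightarrow> 'b) \<Rightarrow> ('a \<Rightarrow> 'b)) category"
  show "category (CP_category R :: (('a, 'e, 'x) cp_pair, 'a \<Rightarrow> 'a) category)"
    by (rule CP_category)
  show "prequadratic_right (CP_category R :: (('a, 'e, 'x) cp_pair, 'a \<Rightarrow> 'a) category)
      (cp_hom_group R)"
    by (rule CP_category_prequadratic)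
  have P_sel: "((M, A), (N, B)) \<in> ob ?P \<longleftrightarrow> cp_module R M A \<and> cp_module R N B"
    "(f, g) \<in> mor ?P (S, T) (S', T') \<longleftrightarrow> f \<in> cp_maps R S' S \<and> g \<in> cp_maps R T T'"
    "idn ?P (S, T) = (idn (CP_category R) S, idn (CP_category R) T)"
    "cmp ?P (S, T) (S', T') (S'', T'') (f', g') (f, g)
      = (cmp (CP_category R) S'' S' S f f', cmp (CP_category R) T T' T'' g' g)"
    for M A N B f g f' g' S T S' T' S'' T''
    by (simp_all add: prod_category_def op_category_def CP_category_def)
  show "cat_functor ?P ?D (internal_Hom_ob R) (internal_Hom_mor R)"
  proof (intro cat_functor.intro cat_functor_axioms.intro category_prod category_op CP_category)
    fix X Y Z :: "('a, 'e, 'x) cp_pair \<times> ('b, 'e, 'x) cp_pair"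
      and F G :: "('a \<Rightarrow> 'a) \<times> ('b \<Rightarrow> 'b)"
    obtain M A N B where X: "X = ((M, A), (N, B))" by (metis surj_pair)
    obtain K D L C where Y: "Y = ((K, D), (L, C))" by (metis surj_pair)
    obtain I E J G' where Z: "Z = ((I, E), (J, G'))" by (metis surj_pair)
    obtain f1 f2 where F: "F = (f1, f2)" by (cases F)
    obtain g1 g2 where G: "G = (g1, g2)" by (cases G)
    show "internal_Hom_ob R X \<in> ob ?D" if "X \<in> ob ?P"
    proof -
      interpret cp_module_pair R M A N B
        using that by (intro cp_module_pairI) (simp_all add: X P_sel)
      show ?thesis
        using Hom_comm_cp_module
        by (simp add: X internal_Hom_ob_def cp_hom_eq CP_category_sel comm_cp_module_def)
    qed
    show "internal_Hom_mor R X Y F \<in> mor ?D (internal_Hom_ob R X) (internal_Hom_ob R Y)"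
      if "X \<in> ob ?P" "Y \<in> ob ?P" "F \<in> mor ?P X Y"
      using that by (simp add: X Y F P_sel internal_Hom_ob_def CP_category_sel internal_Hom_mor_in)
    show "internal_Hom_mor R X X (idn ?P X) = idn ?D (internal_Hom_ob R X)" if "X \<in> ob ?P"
    proof -
      interpret cp_module_pair R M A N B
        using that by (intro cp_module_pairI) (simp_all add: X P_sel)
      have "compose (carrier M) (\<lambda>n\<in>carrier N. n) (compose (carrier M) h (\<lambda>m\<in>carrier M. m)) = h"
        if h: "h \<in> cp_maps R (M, A) (N, B)" for h
        using compose_Id[OF cp_maps_in[OF h]] Id_compose[OF cp_maps_in[OF h]]
          cp_maps_extensional[OF h] by simp
      then show ?thesis
        by (simp add: X P_sel internal_Hom_ob_def cp_hom_eq CP_category_sel internal_Hom_mor_def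
            Hom_sel cong: restrict_cong)
    qed
    show "internal_Hom_mor R X Z (cmp ?P X Y Z G F)
        = cmp ?D (internal_Hom_ob R X) (internal_Hom_ob R Y) (internal_Hom_ob R Z)
            (internal_Hom_mor R Y Z G) (internal_Hom_mor R X Y F)"
      if "X \<in> ob ?P" "Y \<in> ob ?P" "Z \<in> ob ?P" "F \<in> mor ?P X Y" "G \<in> mor ?P Y Z"
    proof -
      have mods: "cp_module R M A" "cp_module R N B" "cp_module R K D" "cp_module R L C"
        and f: "f1 \<in> cp_maps R (K, D) (M, A)" "f2 \<in> cp_maps R (N, B) (L, C)"
        and g1: "g1 \<in> cp_maps R (I, E) (K, D)"
        using that by (simp_all add: X Y Z F G P_sel)
      interpret cp_module_pair R M A N B by (intro cp_module_pairI mods)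
      \<comment> \<open>This and the next fact keep arguments inside the domains of restricted
        functions: the intermediate map lies in the Hom on which the second morphism is defined, and
        the values of \<open>h\<close> lie in the carrier on which the composite of
        \<open>f2\<close> and \<open>g2\<close> is defined.\<close>
      have "compose (carrier K) f2 (compose (carrier K) h f1) \<in> cp_maps R (K, D) (L, C)"
        if "h \<in> cp_maps R (M, A) (N, B)" for h
        using that mods f by (intro compose_cp_maps)
      moreover have "h (f1 (g1 i)) \<in> carrier N"
        if "h \<in> cp_maps R (M, A) (N, B)" "i \<in> carrier I" for h i
        using that cp_maps_in[OF f(1)] cp_maps_in[OF g1] by (auto intro: cp_maps_closed(1))
      ultimately show ?thesis
        using cp_maps_in[OF g1]
        by (auto simp: X Y Z F G P_sel internal_Hom_ob_def cp_hom_eq CP_category_sel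
            internal_Hom_mor_def Hom_sel compose_def fun_eq_iff)
    qed
  qed
qed

end
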